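(* Let $A=[-1,1,1]$ or $A=[-1,1,2]$, viewed as the weight matrix of a unitary action of $\mathbb{S}^1$ on $\mathbb{C}^3$, and let $M_A=J_A^{-1}(0)/\mathbb{S}^1$ be the corresponding symplectic quotient. Then $A$ is simplicial and $M_A$ is homeomorphic to $\mathbb{C}^2$, but for no finite subgroup $H$ of the group $\operatorname{Sp}(\mathbb{R}^4)$ of linear symplectomorphisms of $\mathbb{R}^4$ does there exist a $\mathbb{Z}$-graded regular symplectomorphism from $M_A$ to $\mathbb{R}^4/H$.
   Context: A weight matrix $A=[a_1,a_2,a_3]\in\mathbb{Z}^{1\times3}$ encodes the action $t.(z_1,z_2,z_3)=(t^{a_1}z_1,t^{a_2}z_2,t^{a_3}z_3)$ of $\mathbb{S}^1$ on $\mathbb{C}^3$, with moment map $J_A(z)=\frac12\sum_j a_jz_j\overline{z_j}$. $A$ is simplicial if the cone $\ker(A)\cap\mathbb{R}^3_{\ge0}$ is generated by linearly independent vectors. The Poisson bracket on $\mathcal{C}^\infty(\mathbb{C}^3)$ is determined by $\{z_i,\overline{z_j}\}=\frac{2}{\sqrt{-1}}\delta_{ij}$, other brackets of coordinates being zero. With $Z=J_A^{-1}(0)$ and $I_Z$ the ideal of smooth functions vanishing on $Z$, $M_A=Z/\mathbb{S}^1$ carries the Poisson algebra of functions $\mathcal{C}^\infty(M_A)=\mathcal{C}^\infty(\mathbb{C}^3)^{\mathbb{S}^1}/(\mathcal{C}^\infty(\mathbb{C}^3)^{\mathbb{S}^1}\cap I_Z)$. For finite $H<\operatorname{Sp}(\mathbb{R}^4)$,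 $\mathbb{R}^4/H$ carries the Poisson algebra $\mathcal{C}^\infty(\mathbb{R}^4)^H$, with bracket coming from the standard symplectic form on $\mathbb{R}^4=T^*\mathbb{R}^2$. Poisson differential spaces: a differential space is a topological space $X$ with an algebra $\mathcal{C}^\infty(X)$ of continuous real functions such that the topology is generated by $\mathcal{C}^\infty(X)$, $\mathcal{C}^\infty(X)$ is closed under composition with smooth functions $F\in\mathcal{C}^\infty(\mathbb{R}^k)$, and any function locally agreeing with elements of $\mathcal{C}^\infty(X)$ belongs to $\mathcal{C}^\infty(X)$. A Poisson differential space has in addition a Poisson bracket on $\mathcal{C}^\infty(X)$. Both $M_A$ and $\mathbb{R}^4/H$ are such spaces. A global chart on $X$ is an algebra homomorphism $\varphi\colon\mathbb{R}[x_1,\dots,x_k]\to\mathcal{C}^\infty(X)$, $x_i\mapsto\varphi_i$, such that (1) its image $\mathbb{R}[X]$ is a Poisson subalgebra; (2) every $f\in\mathcal{C}^\infty(X)$ equals $F(\varphi_1,\dots,\varphi_k)$ for some $F\in\mathcal{C}^\infty(\mathbb{R}^k)$; (3) $\mathbb{R}[X]$ separates points. Then $\mathbb{R}[\boldsymbol{x}]/\ker\varphi$ inherits a Poisson bracket. The symbol $\varphi$ also denotes the map $X\to\mathbb{R}^k$, $\xi\mapsto(\varphi_1(\xi),\dots,\varphi_k(\xi))$. The chart is $\mathbb{Z}$-graded if $\mathbb{R}[\boldsymbol{x}]$ carries a $\mathbb{Z}$-grading for which $\ker\varphi$ is homogeneous. On $M_A$ one uses a $\mathbb{Z}$-graded global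 chart sending $x_i$ to the class of $\rho_i$, where $\rho_1,\dots,\rho_k$ is a minimal homogeneous system of generators of the algebra of real $\mathbb{S}^1$-invariant polynomials on $\mathbb{C}^3\cong\mathbb{R}^6$ and $\deg x_i=\deg\rho_i$; on $\mathbb{R}^4/H$ one likewise uses a minimal homogeneous system of generators of $\mathbb{R}[\mathbb{R}^4]^H$ (the choices are immaterial up to $\mathbb{Z}$-graded regular Poisson diffeomorphism). An arrow from $X$ with global chart $\varphi\colon\mathbb{R}[x_1,\dots,x_k]\to\mathcal{C}^\infty(X)$ to $Y$ with global chart $\psi\colon\mathbb{R}[y_1,\dots,y_m]\to\mathcal{C}^\infty(Y)$ is an algebra morphism $\lambda\colon\mathbb{R}[\boldsymbol{y}]\to\mathbb{R}[\boldsymbol{x}]$ such that (i) $\lambda(\ker\psi)\subset\ker\varphi$ and the induced map $\overline{\lambda}\colon\mathbb{R}[\boldsymbol{y}]/\ker\psi\to\mathbb{R}[\boldsymbol{x}]/\ker\varphi$ is compatible with Poisson brackets; (ii) with $\vartheta\colon X\to\mathbb{R}^m$, $\vartheta(\xi)=\big(\varphi(\lambda(y_1))(\xi),\dots,\varphi(\lambda(y_m))(\xi)\big)$, one has $\operatorname{im}(\vartheta)\subset\operatorname{im}(\psi\colon Y\to\mathbb{R}^m)$. It is $\mathbb{Z}$-graded if both charts are $\mathbb{Z}$-graded and $\lambda$ is compatible with the gradings. The arrow lifts to the Poisson map $\chi\colon X\to Y$, $\chi(\xi)=\psi^{-1}(\vartheta(\xi))$. If $\overline\lambda$ is an isomorphism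 and $\operatorname{im}(\vartheta)=\operatorname{im}(\psi)$, then $\chi$ is called a regular symplectomorphism (regular Poisson diffeomorphism); it is $\mathbb{Z}$-graded if the arrow is. *)

theory Defs
  imports "HOL-Analysis.Analysis" "HOL-Algebra.Group" "HOL-Library.Poly_Mapping"
begin

section \<open>Polynomials in finitely many variables\<close>

text \<open>Polynomials in the variables \<open>x\<^sub>i\<close>, \<open>i\<close> a natural number: finitely supported families of
  coefficients indexed by exponent vectors, with the convolution product.\<close>

type_synonym rpoly = "(nat \<Rightarrow>\<^sub>0 nat) \<Rightarrow>\<^sub>0 real"

text \<open>\<open>Pol I\<close> is the subalgebra of polynomials in the variables indexed by \<open>I\<close>; in particular
  \<open>Pol {..<k}\<close> is the polynomial ring in \<open>k\<close> variables.\<close>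

definition Pol :: "nat set \<Rightarrow> rpoly set" where
  "Pol I = {p. \<forall>m\<in>Poly_Mapping.keys p. Poly_Mapping.keys m \<subseteq> I}"

definition Const :: "real \<Rightarrow> rpoly" where
  "Const c = Poly_Mapping.single 0 c"

definition peval :: "rpoly \<Rightarrow> (nat \<Rightarrow> real) \<Rightarrow> real" where
  "peval p x = (\<Sum>m\<in>Poly_Mapping.keys p. Poly_Mapping.lookup p m *
     (\<Prod>i\<in>Poly_Mapping.keys m. x i ^ Poly_Mapping.lookup m i))"

text \<open>Unital homomorphisms of real algebras from polynomials in \<open>m\<close> variables to polynomials in
  \<open>k\<close> variables.\<close>

definition poly_alg_hom :: "nat \<Rightarrow> nat \<Rightarrow> (rpoly \<Rightarrow> rpoly) \<Rightarrow> bool" where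
  "poly_alg_hom m k l \<longleftrightarrow>
     (\<forall>p\<in>Pol {..<m}. l p \<in> Pol {..<k}) \<and>
     (\<forall>c. l (Const c) = Const c) \<and>
     (\<forall>p\<in>Pol {..<m}. \<forall>q\<in>Pol {..<m}. l (p + q) = l p + l q \<and> l (p * q) = l p * l q)"

definition decomposes :: "(int \<Rightarrow> rpoly set) \<Rightarrow> rpoly \<Rightarrow> (int \<Rightarrow> rpoly) \<Rightarrow> bool" where
  "decomposes G p c \<longleftrightarrow>
     finite {d. c d \<noteq> 0} \<and> (\<forall>d. c d \<in> G d) \<and> p = (\<Sum>d\<in>{d. c d \<noteq> 0}. c d)"

definition Z_grading :: "nat \<Rightarrow> (int \<Rightarrow> rpoly set) \<Rightarrow> bool" where
  "Z_grading k G \<longleftrightarrow>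
     (\<forall>d. G d \<subseteq> Pol {..<k} \<and> 0 \<in> G d \<and>
        (\<forall>p\<in>G d. \<forall>q\<in>G d. p + q \<in> G d) \<and> (\<forall>c. \<forall>p\<in>G d. Const c * p \<in> G d)) \<and>
     (\<forall>d e. \<forall>p\<in>G d. \<forall>q\<in>G e. p * q \<in> G (d + e)) \<and>
     (\<forall>p\<in>Pol {..<k}. \<exists>!c. decomposes G p c)"

definition homogeneous_ideal :: "(int \<Rightarrow> rpoly set) \<Rightarrow> rpoly set \<Rightarrow> bool" where
  "homogeneous_ideal G I \<longleftrightarrow> (\<forall>p\<in>I. \<forall>c. decomposes G p c \<longrightarrow> (\<forall>d. c d \<in> I))"

text \<open>The grading of the polynomials in \<open>length ds\<close> variables with \<open>deg x\<^sub>i = ds ! i\<close>.\<close>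

definition weighted_grading :: "nat list \<Rightarrow> int \<Rightarrow> rpoly set" where
  "weighted_grading ds d = {p \<in> Pol {..<length ds}.
     \<forall>m\<in>Poly_Mapping.keys p. int (\<Sum>i<length ds. Poly_Mapping.lookup m i * ds ! i) = d}"


section \<open>Smooth functions\<close>

primrec C_diff :: "nat \<Rightarrow> ('a::euclidean_space \<Rightarrow> real) \<Rightarrow> bool" where
  "C_diff 0 f \<longleftrightarrow> continuous_on UNIV f"
| "C_diff (Suc n) f \<longleftrightarrow>
     (\<forall>x. f differentiable (at x)) \<and> (\<forall>v. C_diff n (\<lambda>x. frechet_derivative f (at x) v))"

definition smooth :: "('a::euclidean_space \<Rightarrow> real) \<Rightarrow> bool" where
  "smooth f \<longleftrightarrow> (\<forall>n. C_diff n f)"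

text \<open>The number of coordinates of a global chart is not a type-level constant, so smoothness on
  \<open>\<real>\<^sup>k\<close> is needed a second time, for the library's space \<^term>\<open>Euclidean_space k\<close>
  of sequences vanishing from index \<open>k\<close> on. It is expressed by iterated partial derivatives;
  \<open>F' i\<close> is the \<open>i\<close>-th partial derivative of \<open>F\<close>.\<close>

primrec C_diff_Rk :: "nat \<Rightarrow> nat \<Rightarrow> ((nat \<Rightarrow> real) \<Rightarrow> real) \<Rightarrow> bool" where
  "C_diff_Rk k 0 F \<longleftrightarrow> continuous_map (Euclidean_space k) euclideanreal F"
| "C_diff_Rk k (Suc n) F \<longleftrightarrow>
     (\<exists>F'. \<forall>i<k. C_diff_Rk k n (F' i) \<and>
        (\<forall>x\<in>topspace (Euclidean_space k).
           ((\<lambda>t. F (x(i := t))) has_real_derivative F' i x) (at (x i))))"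

definition smooth_Rk :: "nat \<Rightarrow> ((nat \<Rightarrow> real) \<Rightarrow> real) \<Rightarrow> bool" where
  "smooth_Rk k F \<longleftrightarrow> (\<forall>n. C_diff_Rk k n F)"


section \<open>Global charts and regular symplectomorphisms\<close>

text \<open>The data of a Poisson differential space. Its points are the elements of
  \<open>topspace (space_top X)\<close>, and functions are extensional on that set.\<close>

record 'x poisson_space =
  space_top :: "'x topology"
  smooth_funs :: "('x \<Rightarrow> real) set"
  pbracket :: "('x \<Rightarrow> real) \<Rightarrow> ('x \<Rightarrow> real) \<Rightarrow> 'x \<Rightarrow> real"

abbreviation points :: "'x poisson_space \<Rightarrow> 'x set" where
  "points X \<equiv> topspace (space_top X)"

text \<open>A chart in \<open>k\<close> variables is given by the list of the \<open>k\<close> images \<open>\<phi>\<^sub>i\<close> of the variables;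
  \<open>chart_hom\<close> is the algebra homomorphism, \<open>chart_map\<close> the map into \<open>\<real>\<^sup>k\<close>.\<close>

type_synonym 'x chart = "('x \<Rightarrow> real) list"

definition chart_map :: "'x chart \<Rightarrow> 'x \<Rightarrow> nat \<Rightarrow> real" where
  "chart_map \<phi> \<xi> = (\<lambda>i. if i < length \<phi> then (\<phi> ! i) \<xi> else 0)"

abbreviation chart_ring :: "'x chart \<Rightarrow> rpoly set" where
  "chart_ring \<phi> \<equiv> Pol {..<length \<phi>}"

definition chart_hom :: "'x poisson_space \<Rightarrow> 'x chart \<Rightarrow> rpoly \<Rightarrow> 'x \<Rightarrow> real" where
  "chart_hom X \<phi> p = (\<lambda>\<xi>\<in>points X. peval p (chart_map \<phi> \<xi>))"

definition chart_ker :: "'x poisson_space \<Rightarrow> 'x chart \<Rightarrow> rpoly set" where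
  "chart_ker X \<phi> = {p \<in> chart_ring \<phi>. \<forall>\<xi>\<in>points X. chart_hom X \<phi> p \<xi> = 0}"

definition global_chart :: "'x poisson_space \<Rightarrow> 'x chart \<Rightarrow> bool" where
  "global_chart X \<phi> \<longleftrightarrow>
     (\<forall>p\<in>chart_ring \<phi>. chart_hom X \<phi> p \<in> smooth_funs X) \<and>
     (\<forall>p\<in>chart_ring \<phi>. \<forall>q\<in>chart_ring \<phi>.
        pbracket X (chart_hom X \<phi> p) (chart_hom X \<phi> q) \<in> chart_hom X \<phi> ` chart_ring \<phi>) \<and>
     (\<forall>f\<in>smooth_funs X. \<exists>F. smooth_Rk (length \<phi>) F \<and>
        (\<forall>\<xi>\<in>points X. f \<xi> = F (chart_map \<phi> \<xi>))) \<and>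
     (\<forall>\<xi>\<in>points X. \<forall>\<eta>\<in>points X. \<xi> \<noteq> \<eta> \<longrightarrow>
        (\<exists>p\<in>chart_ring \<phi>. chart_hom X \<phi> p \<xi> \<noteq> chart_hom X \<phi> p \<eta>))"

definition graded_global_chart ::
    "'x poisson_space \<Rightarrow> 'x chart \<Rightarrow> (int \<Rightarrow> rpoly set) \<Rightarrow> bool" where
  "graded_global_chart X \<phi> G \<longleftrightarrow>
     global_chart X \<phi> \<and> Z_grading (length \<phi>) G \<and> homogeneous_ideal G (chart_ker X \<phi>)"

text \<open>The quotient of the polynomial ring by the kernel of the chart, and its Poisson bracket.\<close>

definition residue_class :: "'x poisson_space \<Rightarrow> 'x chart \<Rightarrow> rpoly \<Rightarrow> rpoly set" where
  "residue_class X \<phi> p = {q \<in> chart_ring \<phi>. q - p \<in> chart_ker X \<phi>}"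

definition residue_ring :: "'x poisson_space \<Rightarrow> 'x chart \<Rightarrow> rpoly set set" where
  "residue_ring X \<phi> = residue_class X \<phi> ` chart_ring \<phi>"

definition residue_bracket ::
    "'x poisson_space \<Rightarrow> 'x chart \<Rightarrow> rpoly set \<Rightarrow> rpoly set \<Rightarrow> rpoly set" where
  "residue_bracket X \<phi> C D = {r \<in> chart_ring \<phi>. \<exists>p\<in>C. \<exists>q\<in>D.
     chart_hom X \<phi> r = pbracket X (chart_hom X \<phi> p) (chart_hom X \<phi> q)}"

definition induced_map ::
    "'x poisson_space \<Rightarrow> 'x chart \<Rightarrow> (rpoly \<Rightarrow> rpoly) \<Rightarrow> rpoly set \<Rightarrow> rpoly set" where
  "induced_map X \<phi> l C = (\<Union>p\<in>C. residue_class X \<phi> (l p))"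

text \<open>The map \<open>\<vartheta>\<close> of an algebra morphism \<open>l\<close> out of the polynomials in \<open>m\<close> variables.\<close>

definition arrow_map ::
    "'x poisson_space \<Rightarrow> 'x chart \<Rightarrow> nat \<Rightarrow> (rpoly \<Rightarrow> rpoly) \<Rightarrow> 'x \<Rightarrow> nat \<Rightarrow> real" where
  "arrow_map X \<phi> m l \<xi> = (\<lambda>i. if i < m
     then chart_hom X \<phi> (l (Poly_Mapping.single (Poly_Mapping.single i 1) 1)) \<xi> else 0)"

definition arrow ::
    "'x poisson_space \<Rightarrow> 'x chart \<Rightarrow> 'y poisson_space \<Rightarrow> 'y chart \<Rightarrow> (rpoly \<Rightarrow> rpoly) \<Rightarrow> bool" where
  "arrow X \<phi> Y \<psi> l \<longleftrightarrow>
     global_chart X \<phi> \<and> global_chart Y \<psi> \<and>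
     poly_alg_hom (length \<psi>) (length \<phi>) l \<and>
     l ` chart_ker Y \<psi> \<subseteq> chart_ker X \<phi> \<and>
     (\<forall>C\<in>residue_ring Y \<psi>. \<forall>D\<in>residue_ring Y \<psi>.
        induced_map X \<phi> l (residue_bracket Y \<psi> C D) =
        residue_bracket X \<phi> (induced_map X \<phi> l C) (induced_map X \<phi> l D)) \<and>
     arrow_map X \<phi> (length \<psi>) l ` points X \<subseteq> chart_map \<psi> ` points Y"

definition graded_arrow ::
    "'x poisson_space \<Rightarrow> 'x chart \<Rightarrow> (int \<Rightarrow> rpoly set) \<Rightarrow>
     'y poisson_space \<Rightarrow> 'y chart \<Rightarrow> (int \<Rightarrow> rpoly set) \<Rightarrow> (rpoly \<Rightarrow> rpoly) \<Rightarrow> bool" where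
  "graded_arrow X \<phi> G Y \<psi> K l \<longleftrightarrow>
     arrow X \<phi> Y \<psi> l \<and> graded_global_chart X \<phi> G \<and> graded_global_chart Y \<psi> K \<and>
     (\<forall>d. l ` K d \<subseteq> G d)"

definition arrow_lifts_to ::
    "'x poisson_space \<Rightarrow> 'x chart \<Rightarrow> 'y poisson_space \<Rightarrow> 'y chart \<Rightarrow> (rpoly \<Rightarrow> rpoly) \<Rightarrow>
     ('x \<Rightarrow> 'y) \<Rightarrow> bool" where
  "arrow_lifts_to X \<phi> Y \<psi> l h \<longleftrightarrow>
     (\<forall>\<xi>\<in>points X. h \<xi> \<in> points Y \<and> chart_map \<psi> (h \<xi>) = arrow_map X \<phi> (length \<psi>) l \<xi>)"

definition graded_regular_symplectomorphism ::
    "'x poisson_space \<Rightarrow> 'x chart \<Rightarrow> (int \<Rightarrow> rpoly set) \<Rightarrow>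
     'y poisson_space \<Rightarrow> 'y chart \<Rightarrow> (int \<Rightarrow> rpoly set) \<Rightarrow> ('x \<Rightarrow> 'y) \<Rightarrow> bool" where
  "graded_regular_symplectomorphism X \<phi> G Y \<psi> K h \<longleftrightarrow>
     (\<exists>l. graded_arrow X \<phi> G Y \<psi> K l \<and> arrow_lifts_to X \<phi> Y \<psi> l h \<and>
        bij_betw (induced_map X \<phi> l) (residue_ring Y \<psi>) (residue_ring X \<phi>) \<and>
        arrow_map X \<phi> (length \<psi>) l ` points X = chart_map \<psi> ` points Y)"


section \<open>Quotients by linear group actions\<close>

text \<open>Throughout, \<open>G\<close> is a group of linear maps, \<open>Z\<close> a \<open>G\<close>-stable set, and the points
  of \<open>Z/G\<close> are the orbits.\<close>

definition orbit_of :: "('a \<Rightarrow> 'a) set \<Rightarrow> 'a \<Rightarrow> 'a set" where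
  "orbit_of G z = (\<lambda>g. g z) ` G"

definition quotient_top ::
    "('a::topological_space \<Rightarrow> 'a) set \<Rightarrow> 'a set \<Rightarrow> 'a set topology" where
  "quotient_top G Z = topology (\<lambda>U. U \<subseteq> orbit_of G ` Z \<and>
     openin (top_of_set Z) {z \<in> Z. orbit_of G z \<in> U})"

lemma openin_quotient_top:
  "openin (quotient_top G Z) U \<longleftrightarrow>
     U \<subseteq> orbit_of G ` Z \<and> openin (top_of_set Z) {z \<in> Z. orbit_of G z \<in> U}"
proof -
  have "istopology (\<lambda>U. U \<subseteq> orbit_of G ` Z \<and>
     openin (top_of_set Z) {z \<in> Z. orbit_of G z \<in> U})"
    unfolding istopology_def
  proof (intro conjI allI impI)
    fix S T
    assume "S \<subseteq> orbit_of G ` Z \<and> openin (top_of_set Z) {z \<in> Z. orbit_of G z \<in> S}"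
      and "T \<subseteq> orbit_of G ` Z \<and> openin (top_of_set Z) {z \<in> Z. orbit_of G z \<in> T}"
    moreover have "{z \<in> Z. orbit_of G z \<in> S \<inter> T} =
        {z \<in> Z. orbit_of G z \<in> S} \<inter> {z \<in> Z. orbit_of G z \<in> T}" by blast
    ultimately show "S \<inter> T \<subseteq> orbit_of G ` Z"
      and "openin (top_of_set Z) {z \<in> Z. orbit_of G z \<in> S \<inter> T}" by auto
  next
    fix \<K>
    assume *: "\<forall>K\<in>\<K>. K \<subseteq> orbit_of G ` Z \<and> openin (top_of_set Z) {z \<in> Z. orbit_of G z \<in> K}"
    then show "\<Union>\<K> \<subseteq> orbit_of G ` Z" by blast
    have "{z \<in> Z. orbit_of G z \<in> \<Union>\<K>} = (\<Union>K\<in>\<K>. {z \<in> Z. orbit_of G z \<in> K})" by blast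
    with * show "openin (top_of_set Z) {z \<in> Z. orbit_of G z \<in> \<Union>\<K>}"
      by (auto intro!: openin_Union)
  qed
  then show ?thesis
    by (simp add: quotient_top_def topology_inverse')
qed

lemma topspace_quotient_top: "topspace (quotient_top G Z) = orbit_of G ` Z"
proof -
  have "{z \<in> Z. orbit_of G z \<in> orbit_of G ` Z} = Z" by blast
  then have "openin (quotient_top G Z) (orbit_of G ` Z)"
    by (simp add: openin_quotient_top)
  then show ?thesis
    by (metis openin_quotient_top openin_subset openin_topspace subset_antisym)
qed

text \<open>The function on \<open>Z/G\<close> induced by a \<open>G\<close>-invariant function.\<close>

definition descend :: "('a \<Rightarrow> 'a) set \<Rightarrow> 'a set \<Rightarrow> ('a \<Rightarrow> real) \<Rightarrow> 'a set \<Rightarrow> real" where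
  "descend G Z f = (\<lambda>\<xi>\<in>orbit_of G ` Z. f (SOME z. z \<in> Z \<and> orbit_of G z = \<xi>))"

definition invariant :: "('a \<Rightarrow> 'a) set \<Rightarrow> ('a \<Rightarrow> real) \<Rightarrow> bool" where
  "invariant G f \<longleftrightarrow> (\<forall>g\<in>G. \<forall>z. f (g z) = f z)"

definition lift_fun ::
    "('a::euclidean_space \<Rightarrow> 'a) set \<Rightarrow> 'a set \<Rightarrow> ('a set \<Rightarrow> real) \<Rightarrow> 'a \<Rightarrow> real" where
  "lift_fun G Z F = (SOME f. smooth f \<and> invariant G f \<and> descend G Z f = F)"

text \<open>Two invariant functions descend to the same function if and only if they agree on \<open>Z\<close>, so
  \<open>smooth_funs\<close> below is the algebra of smooth invariants modulo those vanishing on \<open>Z\<close>. The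
  bracket of two classes is computed on representatives; it does not depend on them if the
  invariants vanishing on \<open>Z\<close> form a Poisson ideal.\<close>

definition reduced_space ::
    "('a::euclidean_space \<Rightarrow> 'a) set \<Rightarrow> 'a set \<Rightarrow>
     (('a \<Rightarrow> real) \<Rightarrow> ('a \<Rightarrow> real) \<Rightarrow> 'a \<Rightarrow> real) \<Rightarrow> 'a set poisson_space" where
  "reduced_space G Z br = \<lparr>
     space_top = quotient_top G Z,
     smooth_funs = descend G Z ` {f. smooth f \<and> invariant G f},
     pbracket = (\<lambda>F K. descend G Z (br (lift_fun G Z F) (lift_fun G Z K))) \<rparr>"

definition invariant_polynomials :: "('a::euclidean_space \<Rightarrow> 'a) set \<Rightarrow> ('a \<Rightarrow> real) set" where
  "invariant_polynomials G = {f. real_polynomial_function f \<and> invariant G f}"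

definition homogeneous_of_degree :: "nat \<Rightarrow> ('a::real_vector \<Rightarrow> real) \<Rightarrow> bool" where
  "homogeneous_of_degree d f \<longleftrightarrow> (\<forall>t z. f (t *\<^sub>R z) = t ^ d * f z)"

definition generated_algebra :: "('a \<Rightarrow> real) list \<Rightarrow> nat set \<Rightarrow> ('a \<Rightarrow> real) set" where
  "generated_algebra \<rho> I = {(\<lambda>z. peval p (\<lambda>i. (\<rho> ! i) z)) | p. p \<in> Pol I}"

definition minimal_homogeneous_generators ::
    "('a::real_vector \<Rightarrow> real) set \<Rightarrow> ('a \<Rightarrow> real) list \<Rightarrow> nat list \<Rightarrow> bool" where
  "minimal_homogeneous_generators R \<rho> ds \<longleftrightarrow>
     length ds = length \<rho> \<and>
     (\<forall>i<length \<rho>. homogeneous_of_degree (ds ! i) (\<rho> ! i)) \<and>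
     generated_algebra \<rho> {..<length \<rho>} = R \<and>
     (\<forall>I. I \<subset> {..<length \<rho>} \<longrightarrow> generated_algebra \<rho> I \<noteq> R)"

text \<open>\<open>\<phi>\<close> with the grading \<open>D\<close> is the chart of \<open>Z/G\<close> given by a minimal homogeneous system of
  generators \<open>\<rho>\<close> of the invariant polynomials.\<close>

definition invariant_chart ::
    "('a::euclidean_space \<Rightarrow> 'a) set \<Rightarrow> 'a set \<Rightarrow> 'a set chart \<Rightarrow> (int \<Rightarrow> rpoly set) \<Rightarrow> bool" where
  "invariant_chart G Z \<phi> D \<longleftrightarrow>
     (\<exists>\<rho> ds. minimal_homogeneous_generators (invariant_polynomials G) \<rho> ds \<and>
        \<phi> = map (descend G Z) \<rho> \<and> D = weighted_grading ds)"


section \<open>Symplectic circle quotients of \<open>\<complex>\<^sup>3\<close>\<close>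

definition circle_act :: "int^3^1 \<Rightarrow> complex \<Rightarrow> complex^3 \<Rightarrow> complex^3" where
  "circle_act A t z = (\<chi> j. t powi (A $ 1 $ j) * z $ j)"

definition circle_group :: "int^3^1 \<Rightarrow> (complex^3 \<Rightarrow> complex^3) set" where
  "circle_group A = circle_act A ` sphere 0 1"

definition moment_map :: "int^3^1 \<Rightarrow> complex^3 \<Rightarrow> real" where
  "moment_map A z = 1/2 * (\<Sum>j\<in>UNIV. real_of_int (A $ 1 $ j) * Re (z $ j * cnj (z $ j)))"

definition zero_level :: "int^3^1 \<Rightarrow> (complex^3) set" where
  "zero_level A = {z. moment_map A z = 0}"

definition simplicial :: "int^3^1 \<Rightarrow> bool" where
  "simplicial A \<longleftrightarrow> (\<exists>B::(real^3) set. independent B \<and>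
     {x. (\<chi> i j. real_of_int (A $ i $ j)) *v x = 0 \<and> (\<forall>j. 0 \<le> x $ j)} = convex_cone hull B)"

text \<open>With \<open>z\<^sub>j = x\<^sub>j + \<i> y\<^sub>j\<close> this is the bracket with \<open>{x\<^sub>j, y\<^sub>j} = 1\<close>. It is stated for
  values in any normed algebra so that it also applies to the complex coordinates.\<close>

definition poisson_C3 ::
    "(complex^3 \<Rightarrow> 'b::real_normed_algebra) \<Rightarrow> (complex^3 \<Rightarrow> 'b) \<Rightarrow> complex^3 \<Rightarrow> 'b" where
  "poisson_C3 f g z = (\<Sum>j\<in>UNIV.
     frechet_derivative f (at z) (axis j 1) * frechet_derivative g (at z) (axis j \<i>) -
     frechet_derivative f (at z) (axis j \<i>) * frechet_derivative g (at z) (axis j 1))"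

lemma poisson_C3_coordinates:
  shows "poisson_C3 (\<lambda>z. z $ i) (\<lambda>z. cnj (z $ j)) z = (if i = j then 2 / \<i> else 0)"
    and "poisson_C3 (\<lambda>z. z $ i) (\<lambda>z. z $ j) z = 0"
    and "poisson_C3 (\<lambda>z. cnj (z $ i)) (\<lambda>z. cnj (z $ j)) z = 0"
proof -
  have 1: "frechet_derivative (\<lambda>z::complex^3. z $ k) (at z) = (\<lambda>z. z $ k)" for k
    by (rule frechet_derivative_at[symmetric])
       (rule bounded_linear_imp_has_derivative, rule bounded_linear_vec_nth)
  have 2: "frechet_derivative (\<lambda>z::complex^3. cnj (z $ k)) (at z) = (\<lambda>z. cnj (z $ k))" for k
    by (rule frechet_derivative_at[symmetric])
       (rule bounded_linear_imp_has_derivative,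
        rule bounded_linear_compose[OF bounded_linear_cnj bounded_linear_vec_nth])
  show "poisson_C3 (\<lambda>z. z $ i) (\<lambda>z. cnj (z $ j)) z = (if i = j then 2 / \<i> else 0)"
    and "poisson_C3 (\<lambda>z. z $ i) (\<lambda>z. z $ j) z = 0"
    and "poisson_C3 (\<lambda>z. cnj (z $ i)) (\<lambda>z. cnj (z $ j)) z = 0"
    using exhaust_3[of i] exhaust_3[of j]
    by (auto simp: poisson_C3_def 1 2 sum_3 axis_def)
qed

definition symplectic_quotient :: "int^3^1 \<Rightarrow> (complex^3) set poisson_space" where
  "symplectic_quotient A = reduced_space (circle_group A) (zero_level A) poisson_C3"


section \<open>Linear symplectic orbifolds\<close>

text \<open>\<open>\<real>\<^sup>4 = T\<^sup>*\<real>\<^sup>2\<close>, with points written as pairs \<open>(q, p)\<close> of position and momentum.\<close>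

type_synonym phase = "(real^2) \<times> (real^2)"

definition symplectic_form :: "phase \<Rightarrow> phase \<Rightarrow> real" where
  "symplectic_form u v = fst u \<bullet> snd v - snd u \<bullet> fst v"

definition poisson_R4 :: "(phase \<Rightarrow> real) \<Rightarrow> (phase \<Rightarrow> real) \<Rightarrow> phase \<Rightarrow> real" where
  "poisson_R4 f g x = (\<Sum>i\<in>UNIV.
     frechet_derivative f (at x) (axis i 1, 0) * frechet_derivative g (at x) (0, axis i 1) -
     frechet_derivative f (at x) (0, axis i 1) * frechet_derivative g (at x) (axis i 1, 0))"

definition Sp_R4 :: "(phase \<Rightarrow> phase) monoid" where
  "Sp_R4 = \<lparr> carrier = {h. linear h \<and>
       (\<forall>u v. symplectic_form (h u) (h v) = symplectic_form u v)},
     mult = (\<circ>), one = id \<rparr>"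

definition linear_quotient :: "(phase \<Rightarrow> phase) set \<Rightarrow> phase set poisson_space" where
  "linear_quotient H = reduced_space H UNIV poisson_R4"

end

theory Submission
  imports Defs
begin

text \<open>
  Everything holds for the weights \<open>[-1, 1, a]\<close> with any integer \<open>a \<ge> 1\<close>, and is proved in that
  generality. On the zero level \<open>Z\<close> of the moment map one has \<open>|z\<^sub>1|\<^sup>2 = |z\<^sub>2|\<^sup>2 + a |z\<^sub>3|\<^sup>2\<close>, so \<open>z\<^sub>1\<close> vanishes only at the origin, and rotating
  \<open>z\<^sub>1\<close> to the nonnegative real axis turns \<open>(z\<^sub>2, z\<^sub>3)\<close> into global coordinates on the quotient. This gives the
  homeomorphism with \<open>\<complex>\<^sup>2\<close> (\<open>symplectic_quotient_weights_homeomorphic\<close>).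

  For the nonexistence, consider the quadratic invariants
  \<open>A = |z\<^sub>1|\<^sup>2\<close>, \<open>B = |z\<^sub>2|\<^sup>2\<close>, \<open>R = Re z\<^sub>1z\<^sub>2\<close>, \<open>S = Im z\<^sub>1z\<^sub>2\<close>, which satisfy \<open>R\<^sup>2 + S\<^sup>2 = A B\<close>.
  A graded regular symplectomorphism to \<open>\<real>\<^sup>4/H\<close> carries them to quadratic forms on \<open>\<real>\<^sup>4\<close> with the
  same relation and the same joint values
  (\<open>graded_symplectomorphism_transports_invariants\<close>, \<open>homogeneous_quadratic_polynomial\<close>). There
  the form \<open>A\<close> is positive definite, hence irreducible over \<open>\<complex>\<close>, and \<open>A B = (R + iS)(R - iS)\<close> forces
  \<open>R + iS\<close> to be a constant multiple of \<open>A\<close>; but \<open>z\<^sub>1z\<^sub>2\<close> is not a constant multiple of \<open>|z\<^sub>1|\<^sup>2\<close> on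
  \<open>Z\<close>. The lemma \<open>no_quadratic_model\<close> replaces the factorisation by linear algebra with three vectors,
  representing the images of the orbits of \<open>(1, 1, 0)\<close>, \<open>(1, -1, 0)\<close> and \<open>(\<surd>a, 0, 1)\<close>.
\<close>

section \<open>Evaluation of polynomials\<close>

abbreviation Var :: "nat \<Rightarrow> rpoly" where
  "Var i \<equiv> Poly_Mapping.single (Poly_Mapping.single i 1) 1"

definition monomial_value :: "(nat \<Rightarrow> real) \<Rightarrow> (nat \<Rightarrow>\<^sub>0 nat) \<Rightarrow> real" where
  "monomial_value x m = (\<Prod>i\<in>Poly_Mapping.keys m. x i ^ Poly_Mapping.lookup m i)"

lemma monomial_value_superset:
  assumes "finite I" "Poly_Mapping.keys m \<subseteq> I"
  shows "monomial_value x m = (\<Prod>i\<in>I. x i ^ Poly_Mapping.lookup m i)"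
  unfolding monomial_value_def
  using assms by (intro prod.mono_neutral_left) (simp_all add: in_keys_iff)

lemma monomial_value_add:
  "monomial_value x (m + n) = monomial_value x m * monomial_value x n"
proof -
  let ?I = "Poly_Mapping.keys m \<union> Poly_Mapping.keys n"
  have "Poly_Mapping.keys (m + n) \<subseteq> ?I" by (rule Poly_Mapping.keys_add)
  then show ?thesis
    by (simp add: monomial_value_superset[of ?I] lookup_add power_add prod.distrib)
qed

lemma peval_superset:
  assumes "finite K" "Poly_Mapping.keys p \<subseteq> K"
  shows "peval p x = (\<Sum>m\<in>K. Poly_Mapping.lookup p m * monomial_value x m)"
  unfolding peval_def monomial_value_def
  using assms by (intro sum.mono_neutral_left) (simp_all add: in_keys_iff)

lemma peval_add: "peval (p + q) x = peval p x + peval q x"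
proof -
  let ?K = "Poly_Mapping.keys p \<union> Poly_Mapping.keys q"
  have "Poly_Mapping.keys (p + q) \<subseteq> ?K" by (rule Poly_Mapping.keys_add)
  then show ?thesis
    by (simp add: peval_superset[of ?K] lookup_add distrib_right sum.distrib)
qed

lemma peval_single: "peval (Poly_Mapping.single m c) x = c * monomial_value x m"
  by (cases "c = 0") (simp_all add: peval_def monomial_value_def)

lemma peval_zero [simp]: "peval 0 x = 0"
  by (simp add: peval_def)

lemma peval_Const [simp]: "peval (Const c) x = c"
  by (simp add: Const_def peval_single monomial_value_def)

lemma peval_Var [simp]: "peval (Var i) x = x i"
  by (simp add: peval_single monomial_value_def)

lemma peval_diff: "peval (p - q) x = peval p x - peval q x"
  using peval_add[of "p - q" q x] by simp

lemma peval_sum: "peval (\<Sum>i\<in>I. p i) x = (\<Sum>i\<in>I. peval (p i) x)"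
  by (induction I rule: infinite_finite_induct) (simp_all add: peval_add)

lemma update_eq_add_single:
  assumes "a \<notin> Poly_Mapping.keys f"
  shows "Poly_Mapping.update a b f = f + Poly_Mapping.single a b"
proof (rule poly_mapping_eqI)
  fix k
  have "Poly_Mapping.lookup f a = 0" using assms by (simp add: not_in_keys_iff_lookup_eq_zero)
  then show "Poly_Mapping.lookup (Poly_Mapping.update a b f) k =
      Poly_Mapping.lookup (f + Poly_Mapping.single a b) k"
    by (auto simp: lookup_update lookup_add lookup_single when_def)
qed

lemma keys_add_single:
  assumes "a \<notin> Poly_Mapping.keys f" "b \<noteq> 0"
  shows "Poly_Mapping.keys (f + Poly_Mapping.single a b) = insert a (Poly_Mapping.keys f)"
proof (rule Set.set_eqI)
  fix x
  have "Poly_Mapping.lookup f a = 0" using assms(1) by (simp add: not_in_keys_iff_lookup_eq_zero)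
  then show "x \<in> Poly_Mapping.keys (f + Poly_Mapping.single a b) \<longleftrightarrow>
      x \<in> insert a (Poly_Mapping.keys f)"
    using assms(2)
    by (cases "x = a") (simp_all add: in_keys_iff lookup_add lookup_single when_def)
qed

lemma poly_mapping_add_single_induct [case_names zero add_single]:
  assumes "P 0"
    and "\<And>f a b. a \<notin> Poly_Mapping.keys f \<Longrightarrow> P f \<Longrightarrow> P (f + Poly_Mapping.single a b)"
  shows "P f"
proof (induction f rule: update_induct)
  case const
  show ?case by (rule assms(1))
next
  case (update f a b)
  then show ?case by (simp add: update_eq_add_single assms(2))
qed

lemma peval_mult: "peval (p * q) x = peval p x * peval q x"
proof (induction p rule: poly_mapping_add_single_induct)
  case zero
  show ?case by simp
next
  case (add_single f a b)
  have "peval (Poly_Mapping.single a b * q) x = peval (Poly_Mapping.single a b) x * peval q x"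
  proof (induction q rule: poly_mapping_add_single_induct)
    case (add_single g c d)
    then show ?case
      by (simp add: distrib_left peval_add peval_single mult_single monomial_value_add)
  qed simp
  with add_single show ?case
    by (simp add: distrib_right peval_add)
qed

lemma peval_cong:
  assumes "p \<in> Pol I" "\<And>i. i \<in> I \<Longrightarrow> x i = y i"
  shows "peval p x = peval p y"
  unfolding peval_def
proof (intro sum.cong refl arg_cong2[where f = "(*)"] prod.cong)
  fix m i
  assume "m \<in> Poly_Mapping.keys p" "i \<in> Poly_Mapping.keys m"
  with assms(1) have "i \<in> I" by (auto simp: Pol_def)
  then show "x i ^ Poly_Mapping.lookup m i = y i ^ Poly_Mapping.lookup m i"
    by (simp add: assms(2))
qed

lemma zero_in_Pol: "0 \<in> Pol I"
  by (simp add: Pol_def)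

lemma Const_in_Pol: "Const c \<in> Pol I"
  by (simp add: Pol_def Const_def)

lemma Var_in_Pol: "i \<in> I \<Longrightarrow> Var i \<in> Pol I"
  by (simp add: Pol_def)

lemma Pol_add: "p \<in> Pol I \<Longrightarrow> q \<in> Pol I \<Longrightarrow> p + q \<in> Pol I"
  unfolding Pol_def using Poly_Mapping.keys_add[of p q] by blast

lemma Pol_mult: "p \<in> Pol I \<Longrightarrow> q \<in> Pol I \<Longrightarrow> p * q \<in> Pol I"
  unfolding Pol_def mem_Collect_eq
proof
  fix m
  assume *: "\<forall>m\<in>Poly_Mapping.keys p. Poly_Mapping.keys m \<subseteq> I"
    "\<forall>m\<in>Poly_Mapping.keys q. Poly_Mapping.keys m \<subseteq> I" and "m \<in> Poly_Mapping.keys (p * q)"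
  then obtain a b where "m = a + b" "a \<in> Poly_Mapping.keys p" "b \<in> Poly_Mapping.keys q"
    using Poly_Mapping.keys_mult[of p q] by blast
  with * show "Poly_Mapping.keys m \<subseteq> I" using Poly_Mapping.keys_add[of a b] by blast
qed

lemma Pol_sum: "(\<And>i. i \<in> J \<Longrightarrow> p i \<in> Pol I) \<Longrightarrow> (\<Sum>i\<in>J. p i) \<in> Pol I"
  by (induction J rule: infinite_finite_induct) (simp_all add: zero_in_Pol Pol_add)

lemma monomial_in_Pol_induct:
  assumes "Poly_Mapping.keys m \<subseteq> I"
    and one: "P (Const 1)"
    and Var: "\<And>i. i \<in> I \<Longrightarrow> P (Var i)"
    and mult: "\<And>p q. p \<in> Pol I \<Longrightarrow> q \<in> Pol I \<Longrightarrow> P p \<Longrightarrow> P q \<Longrightarrow> P (p * q)"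
  shows "P (Poly_Mapping.single m 1)"
  using assms(1)
proof (induction m rule: poly_mapping_add_single_induct)
  case zero
  with one show ?case by (simp add: Const_def)
next
  case (add_single m i n)
  show ?case
  proof (cases "n = 0")
    case True
    with add_single show ?thesis by simp
  next
    case False
    have "Poly_Mapping.keys (m + Poly_Mapping.single i n) = insert i (Poly_Mapping.keys m)"
      using add_single.hyps False
      by (simp add: keys_add_single)
    with add_single.prems have i: "i \<in> I" and m: "Poly_Mapping.keys m \<subseteq> I" by auto
    have "P (Poly_Mapping.single (m + Poly_Mapping.single i k) 1)" for k
    proof (induction k)
      case 0
      with add_single.IH m show ?case by simp
    next
      case (Suc k)
      have "(Poly_Mapping.single (m + Poly_Mapping.single i (Suc k)) 1 :: rpoly) =
          Poly_Mapping.single (m + Poly_Mapping.single i k) 1 * Var i"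
        by (simp add: mult_single add.assoc single_add[symmetric])
      moreover have "(Poly_Mapping.single (m + Poly_Mapping.single i k) 1 :: rpoly) \<in> Pol I"
        using m i Poly_Mapping.keys_add[of m "Poly_Mapping.single i k"]
        by (auto simp: Pol_def split: if_splits)
      ultimately show ?case
        using Suc mult[OF _ Var_in_Pol[OF i] _ Var[OF i]] by simp
    qed
    then show ?thesis .
  qed
qed

text \<open>The polynomial ring is generated as an algebra by constants and variables. This is what makes an
  algebra homomorphism determined by the images of the variables, as in \<open>peval_poly_alg_hom\<close>.\<close>

lemma Pol_induct [consumes 1, case_names Const Var add mult]:
  assumes "p \<in> Pol I"
    and Const: "\<And>c. P (Const c)"
    and Var: "\<And>i. i \<in> I \<Longrightarrow> P (Var i)"
    and add: "\<And>p q. p \<in> Pol I \<Longrightarrow> q \<in> Pol I \<Longrightarrow> P p \<Longrightarrow> P q \<Longrightarrow> P (p + q)"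
    and mult: "\<And>p q. p \<in> Pol I \<Longrightarrow> q \<in> Pol I \<Longrightarrow> P p \<Longrightarrow> P q \<Longrightarrow> P (p * q)"
  shows "P p"
  using assms(1)
proof (induction p rule: poly_mapping_add_single_induct)
  case zero
  with Const[of 0] show ?case by (simp add: Const_def)
next
  case (add_single f m b)
  show ?case
  proof (cases "b = 0")
    case True
    with add_single show ?thesis by simp
  next
    case False
    have "Poly_Mapping.keys (f + Poly_Mapping.single m b) = insert m (Poly_Mapping.keys f)"
      using add_single.hyps False
      by (simp add: keys_add_single)
    with add_single.prems have m: "Poly_Mapping.keys m \<subseteq> I" and f: "f \<in> Pol I"
      by (auto simp: Pol_def)
    have *: "Poly_Mapping.single m b = Const b * Poly_Mapping.single m 1"
      by (simp add: Const_def mult_single)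
    have m1: "(Poly_Mapping.single m 1 :: rpoly) \<in> Pol I" using m by (simp add: Pol_def)
    have Pm1: "P (Poly_Mapping.single m 1)"
      using m Const Var mult by (rule monomial_in_Pol_induct[where P = P])
    have "P (Poly_Mapping.single m b)"
      unfolding * by (rule mult[OF Const_in_Pol m1 Const Pm1])
    moreover have "Poly_Mapping.single m b \<in> Pol I"
      unfolding * by (rule Pol_mult[OF Const_in_Pol m1])
    ultimately show ?thesis
      by (intro add[OF f _ add_single.IH[OF f]])
  qed
qed

lemma poly_alg_hom_sum:
  assumes l: "poly_alg_hom m k l" and "finite J" "\<And>i. i \<in> J \<Longrightarrow> p i \<in> Pol {..<m}"
  shows "l (\<Sum>i\<in>J. p i) = (\<Sum>i\<in>J. l (p i))"
  using assms(2,3)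
proof (induction J)
  case empty
  have "l (Const 0) = Const 0" using l by (simp add: poly_alg_hom_def)
  then show ?case by (simp add: Const_def)
next
  case (insert j J)
  moreover have "(\<Sum>i\<in>J. p i) \<in> Pol {..<m}" using insert by (intro Pol_sum) auto
  ultimately show ?case using l by (simp add: poly_alg_hom_def)
qed

lemma peval_poly_alg_hom:
  assumes l: "poly_alg_hom m k l" and "p \<in> Pol {..<m}"
  shows "peval (l p) x = peval p (\<lambda>i. peval (l (Var i)) x)"
  using assms(2)
  by (induction p rule: Pol_induct)
     (use l in \<open>simp_all add: poly_alg_hom_def peval_add peval_mult del: One_nat_def\<close>)

lemma peval_weighted:
  assumes p: "p \<in> weighted_grading ds d"
  shows "peval p (\<lambda>i. t ^ (ds ! i) * x i) = t ^ nat d * peval p x"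
proof -
  have "monomial_value (\<lambda>i. t ^ (ds ! i) * x i) m = t ^ nat d * monomial_value x m"
    if m: "m \<in> Poly_Mapping.keys p" for m
  proof -
    have keys: "Poly_Mapping.keys m \<subseteq> {..<length ds}"
      and d: "int (\<Sum>i<length ds. Poly_Mapping.lookup m i * ds ! i) = d"
      using p m by (auto simp: weighted_grading_def Pol_def)
    have nd: "nat d = (\<Sum>i<length ds. ds ! i * Poly_Mapping.lookup m i)"
      using d by (metis (no_types, lifting) mult.commute nat_int sum.cong)
    show ?thesis
      by (simp add: monomial_value_superset[OF _ keys] power_mult_distrib prod.distrib nd
          power_sum power_mult)
  qed
  then have "peval p (\<lambda>i. t ^ (ds ! i) * x i) =
      (\<Sum>m\<in>Poly_Mapping.keys p. t ^ nat d * (Poly_Mapping.lookup p m * monomial_value x m))"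
    unfolding peval_superset[OF finite_keys order_refl] by (intro sum.cong) auto
  then show ?thesis
    by (simp only: peval_superset[OF finite_keys order_refl] sum_distrib_left)
qed

section \<open>Transporting homogeneous invariants\<close>

lemma invariant_at_orbit_representative:
  assumes "G \<noteq> {}" "\<And>g z. g \<in> G \<Longrightarrow> f (g z) = f z" "z \<in> Z"
  shows "f (SOME w. w \<in> Z \<and> orbit_of G w = orbit_of G z) = f z"
proof -
  define w where "w = (SOME w. w \<in> Z \<and> orbit_of G w = orbit_of G z)"
  have "w \<in> Z \<and> orbit_of G w = orbit_of G z"
    unfolding w_def by (rule someI[of _ z]) (use assms in simp)
  then obtain g h where "g \<in> G" "h \<in> G" "g w = h z"
    using assms(1) by (fastforce simp: orbit_of_def)
  then have "f w = f z" using assms(2) by metis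
  then show ?thesis by (simp add: w_def)
qed

lemma descend_orbit_of:
  assumes "G \<noteq> {}" "invariant G f" "z \<in> Z"
  shows "descend G Z f (orbit_of G z) = f z"
  using assms invariant_at_orbit_representative[of G f z Z]
  by (simp add: descend_def invariant_def)

lemma coeff_of_power_sum_identity:
  fixes a :: "int \<Rightarrow> real"
  assumes "finite S" "\<And>d. d \<in> S \<Longrightarrow> 0 \<le> d"
    and "\<And>t. (\<Sum>d\<in>S. t ^ nat d * a d) = t ^ n * b"
  shows "(if int n \<in> S then a (int n) else 0) = b"
proof -
  have "poly (\<Sum>d\<in>S. monom (a d) (nat d)) t = poly (monom b n) t" for t
    using assms(3)[of t] by (simp add: poly_sum poly_monom mult.commute)
  then have "(\<Sum>d\<in>S. monom (a d) (nat d)) = monom b n"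
    by (simp add: poly_eq_poly_eq_iff[symmetric] fun_eq_iff)
  then have "(\<Sum>d\<in>S. coeff (monom (a d) (nat d)) n) = b"
    by (metis coeff_monom coeff_sum)
  moreover have "(\<Sum>d\<in>S. coeff (monom (a d) (nat d)) n) = (\<Sum>d\<in>S. if d = int n then a d else 0)"
    using assms(2) by (intro sum.cong refl) auto
  ultimately show ?thesis using assms(1) by (simp add: sum.delta')
qed

lemma generator_in_generated_algebra:
  assumes "i \<in> I"
  shows "\<rho> ! i \<in> generated_algebra \<rho> I"
proof -
  have "\<rho> ! i = (\<lambda>z. peval (Var i) (\<lambda>i. (\<rho> ! i) z))" by (simp del: One_nat_def)
  then show ?thesis using assms Var_in_Pol unfolding generated_algebra_def by blast
qed

text \<open>The relation \<open>C\<close> pairs a point of \<open>Z\<close> with a point of \<open>W\<close> when the arrow sends the first to the chart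
  image of the second; equality of images makes it total on both sides, so that pointwise relations
  and inequalities between invariants on \<open>Z\<close> carry over to \<open>W\<close>. An invariant \<open>f\<close> of degree \<open>n\<close> is the value of
  \<open>l q\<close> for some \<open>q\<close>, by surjectivity of the map of residue rings. Since \<open>Z\<close> is a cone, comparing powers
  of \<open>t\<close> in \<open>f (t z)\<close> shows that the degree \<open>n\<close> component of \<open>q\<close> alone already gives \<open>f\<close>.\<close>

lemma graded_symplectomorphism_transports_invariants:
  fixes G :: "('a::euclidean_space \<Rightarrow> 'a) set" and H :: "('b::euclidean_space \<Rightarrow> 'b) set"
  assumes "invariant_chart G Z \<phi> D" "invariant_chart H W \<psi> E"
    and "graded_regular_symplectomorphism (reduced_space G Z br) \<phi> D (reduced_space H W br') \<psi> E h"
    and ne: "G \<noteq> {}" "H \<noteq> {}"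
    and cone: "\<forall>t. \<forall>z\<in>Z. t *\<^sub>R z \<in> Z"
  shows "\<exists>C. (\<forall>z\<in>Z. \<exists>y\<in>W. C z y) \<and> (\<forall>y\<in>W. \<exists>z\<in>Z. C z y) \<and>
    (\<forall>f\<in>invariant_polynomials G. \<forall>n. homogeneous_of_degree n f \<longrightarrow>
       (\<exists>Q\<in>invariant_polynomials H. homogeneous_of_degree n Q \<and>
         (\<forall>z\<in>Z. \<forall>y\<in>W. C z y \<longrightarrow> Q y = f z)))"
proof -
  define X where "X = reduced_space G Z br"
  define Y where "Y = reduced_space H W br'"
  have pX: "points X = orbit_of G ` Z" and pY: "points Y = orbit_of H ` W"
    by (simp_all add: X_def Y_def reduced_space_def topspace_quotient_top)
  obtain \<rho> ds where \<rho>: "minimal_homogeneous_generators (invariant_polynomials G) \<rho> ds"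
    and \<phi>: "\<phi> = map (descend G Z) \<rho>" and D: "D = weighted_grading ds"
    using assms(1) by (auto simp: invariant_chart_def)
  obtain \<sigma> es where \<sigma>: "minimal_homogeneous_generators (invariant_polynomials H) \<sigma> es"
    and \<psi>: "\<psi> = map (descend H W) \<sigma>" and E: "E = weighted_grading es"
    using assms(2) by (auto simp: invariant_chart_def)
  obtain l where "graded_arrow X \<phi> D Y \<psi> E l"
    and bij: "bij_betw (induced_map X \<phi> l) (residue_ring Y \<psi>) (residue_ring X \<phi>)"
    and im: "arrow_map X \<phi> (length \<psi>) l ` points X = chart_map \<psi> ` points Y"
    using assms(3) by (auto simp: graded_regular_symplectomorphism_def X_def Y_def)
  then have l: "poly_alg_hom (length \<psi>) (length \<phi>) l"
    and lgr: "\<And>d p. p \<in> E d \<Longrightarrow> l p \<in> D d" and grad: "Z_grading (length \<psi>) E"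
    unfolding graded_arrow_def arrow_def graded_global_chart_def by blast+
  have gen_inv: "\<rho> ! i \<in> invariant_polynomials G" if "i < length \<rho>" for i
    using that \<rho> generator_in_generated_algebra[of i "{..<length \<rho>}" \<rho>]
    by (simp add: minimal_homogeneous_generators_def)
  have gen_inv': "\<sigma> ! i \<in> invariant_polynomials H" if "i < length \<sigma>" for i
    using that \<sigma> generator_in_generated_algebra[of i "{..<length \<sigma>}" \<sigma>]
    by (simp add: minimal_homogeneous_generators_def)
  have chart\<phi>: "chart_map \<phi> (orbit_of G z) i = (\<rho> ! i) z" if "i < length \<phi>" "z \<in> Z" for i z
    using that gen_inv ne by (simp add: chart_map_def \<phi> descend_orbit_of invariant_polynomials_def)
  have chart\<psi>: "chart_map \<psi> (orbit_of H y) i = (\<sigma> ! i) y" if "i < length \<psi>" "y \<in> W" for i y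
    using that gen_inv' ne by (simp add: chart_map_def \<psi> descend_orbit_of invariant_polynomials_def)
  have lens: "length ds = length \<phi>" "length es = length \<psi>"
    using \<rho> \<sigma> by (simp_all add: minimal_homogeneous_generators_def \<phi> \<psi>)
  define F where "F p z = peval p (\<lambda>i. (\<rho> ! i) z)" for p z
  have F_orbit: "chart_hom X \<phi> p (orbit_of G z) = F p z" if "p \<in> chart_ring \<phi>" "z \<in> Z" for p z
    using that by (auto simp: chart_hom_def pX F_def chart\<phi> intro!: peval_cong)
  define C where "C z y \<longleftrightarrow>
    arrow_map X \<phi> (length \<psi>) l (orbit_of G z) = chart_map \<psi> (orbit_of H y)" for z y
  have lq: "F (l q) z = peval q (\<lambda>i. (\<sigma> ! i) y)"
    if q: "q \<in> chart_ring \<psi>" and zy: "z \<in> Z" "y \<in> W" "C z y" for q z y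
  proof -
    have "F (l (Var i)) z = (\<sigma> ! i) y" if "i < length \<psi>" for i
    proof -
      have "l (Var i) \<in> chart_ring \<phi>"
        using l that Var_in_Pol[of i "{..<length \<psi>}"] unfolding poly_alg_hom_def by blast
      then have "F (l (Var i)) z = arrow_map X \<phi> (length \<psi>) l (orbit_of G z) i"
        using that zy by (simp add: arrow_map_def F_orbit)
      then show ?thesis using zy that by (simp add: C_def chart\<psi>)
    qed
    then show ?thesis
      unfolding F_def peval_poly_alg_hom[OF l q] by (intro peval_cong[OF q]) simp
  qed
  have F_homogeneous: "F p (t *\<^sub>R z) = t ^ nat d * F p z" if p: "p \<in> D d" for p t z d
  proof -
    have "p \<in> chart_ring \<phi>" using p by (simp add: D weighted_grading_def lens)
    then have "F p (t *\<^sub>R z) = peval p (\<lambda>i. t ^ (ds ! i) * (\<rho> ! i) z)"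
      unfolding F_def using \<rho>
      by (intro peval_cong)
         (auto simp: minimal_homogeneous_generators_def homogeneous_of_degree_def \<phi>)
    with p show ?thesis by (simp add: F_def D peval_weighted)
  qed
  show ?thesis
  proof (intro exI[of _ C] conjI ballI allI impI)
    show "\<exists>y\<in>W. C z y" if "z \<in> Z" for z
      using im that unfolding pX pY C_def by blast
    show "\<exists>z\<in>Z. C z y" if "y \<in> W" for y
    proof -
      have "chart_map \<psi> (orbit_of H y) \<in> arrow_map X \<phi> (length \<psi>) l ` points X"
        unfolding im pY using that by blast
      then show ?thesis unfolding pX C_def by force
    qed
    fix f n
    assume f: "f \<in> invariant_polynomials G" and fhom: "homogeneous_of_degree n f"
    obtain p where p: "p \<in> chart_ring \<phi>" and fp: "f = F p"
    proof -
      have "f \<in> generated_algebra \<rho> {..<length \<phi>}"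
        using f \<rho> by (simp add: minimal_homogeneous_generators_def \<phi>)
      then obtain p where "p \<in> chart_ring \<phi>" "f = (\<lambda>z. peval p (\<lambda>i. (\<rho> ! i) z))"
        unfolding generated_algebra_def by blast
      then show thesis using that[of p] by (simp add: F_def fun_eq_iff)
    qed
    obtain q where q: "q \<in> chart_ring \<psi>"
      and qp: "induced_map X \<phi> l (residue_class Y \<psi> q) = residue_class X \<phi> p"
    proof -
      have "residue_class X \<phi> p \<in> induced_map X \<phi> l ` residue_ring Y \<psi>"
        using p bij by (simp add: bij_betw_def residue_ring_def)
      then show ?thesis using that by (auto simp: residue_ring_def)
    qed
    have lqr: "l q \<in> chart_ring \<phi>" using l q by (simp add: poly_alg_hom_def)
    have "0 \<in> chart_ker X \<phi>" "0 \<in> chart_ker Y \<psi>"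
      by (auto simp: chart_ker_def chart_hom_def zero_in_Pol)
    then have "q \<in> residue_class Y \<psi> q" "l q \<in> residue_class X \<phi> (l q)"
      using q lqr by (simp_all add: residue_class_def)
    then have "l q \<in> residue_class X \<phi> p" using qp by (auto simp: induced_map_def)
    then have ker: "l q - p \<in> chart_ker X \<phi>" by (simp add: residue_class_def)
    have fq: "f z = F (l q) z" if "z \<in> Z" for z
    proof -
      have "F (l q - p) z = 0"
        using ker that F_orbit[of "l q - p" z] by (auto simp: chart_ker_def pX)
      then show ?thesis by (simp add: fp F_def peval_diff)
    qed
    obtain c where c: "decomposes E q c"
      using grad q unfolding Z_grading_def by blast
    let ?S = "{d. c d \<noteq> 0}"
    have S: "finite ?S" and cE: "\<And>d. c d \<in> E d" and qc: "q = (\<Sum>d\<in>?S. c d)"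
      using c unfolding decomposes_def by blast+
    have c_ring: "c d \<in> chart_ring \<psi>" for d
      using cE[of d] by (simp add: E weighted_grading_def lens)
    have nonneg: "0 \<le> d" if "d \<in> ?S" for d
    proof -
      have "Poly_Mapping.keys (c d) \<noteq> {}" using that by simp
      then obtain m where "m \<in> Poly_Mapping.keys (c d)" by blast
      then show ?thesis using cE[of d] by (auto simp: E weighted_grading_def intro!: sum_nonneg)
    qed
    have l0: "l 0 = 0" using poly_alg_hom_sum[OF l, of "{}"] by simp
    have fn: "F (l (c (int n))) z = f z" if z: "z \<in> Z" for z
    proof -
      have "(\<Sum>d\<in>?S. t ^ nat d * F (l (c d)) z) = t ^ n * f z" for t
      proof -
        have "t ^ n * f z = f (t *\<^sub>R z)"
          using fhom by (simp add: homogeneous_of_degree_def)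
        also have "\<dots> = F (l q) (t *\<^sub>R z)" using z cone fq by simp
        also have "l q = (\<Sum>d\<in>?S. l (c d))"
          using poly_alg_hom_sum[OF l S, of c] c_ring qc by simp
        also have "F \<dots> (t *\<^sub>R z) = (\<Sum>d\<in>?S. F (l (c d)) (t *\<^sub>R z))"
          by (simp add: F_def peval_sum)
        also have "\<dots> = (\<Sum>d\<in>?S. t ^ nat d * F (l (c d)) z)"
          using F_homogeneous[OF lgr[OF cE]] by simp
        finally show ?thesis by simp
      qed
      from coeff_of_power_sum_identity[OF S nonneg this]
      show ?thesis by (auto simp: l0 F_def split: if_splits)
    qed
    define Q where "Q y = peval (c (int n)) (\<lambda>i. (\<sigma> ! i) y)" for y
    have "Q = (\<lambda>y. peval (c (int n)) (\<lambda>i. (\<sigma> ! i) y))" by (simp add: Q_def fun_eq_iff)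
    then have "Q \<in> generated_algebra \<sigma> {..<length \<psi>}"
      using c_ring[of "int n"] unfolding generated_algebra_def by blast
    then have "Q \<in> invariant_polynomials H"
      using \<sigma> by (simp add: minimal_homogeneous_generators_def \<psi>)
    moreover have "homogeneous_of_degree n Q"
      unfolding homogeneous_of_degree_def
    proof (intro allI)
      fix t y
      have "Q (t *\<^sub>R y) = peval (c (int n)) (\<lambda>i. t ^ (es ! i) * (\<sigma> ! i) y)"
        unfolding Q_def using \<sigma>
        by (intro peval_cong[OF c_ring])
           (auto simp: minimal_homogeneous_generators_def homogeneous_of_degree_def \<psi>)
      with cE[of "int n"] show "Q (t *\<^sub>R y) = t ^ n * Q y" by (simp add: Q_def E peval_weighted)
    qed
    moreover have "Q y = f z" if "z \<in> Z" "y \<in> W" "C z y" for z y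
      using that fn lq[OF c_ring[of "int n"]] by (simp add: Q_def)
    ultimately show "\<exists>Q\<in>invariant_polynomials H. homogeneous_of_degree n Q \<and>
         (\<forall>z\<in>Z. \<forall>y\<in>W. C z y \<longrightarrow> Q y = f z)" by blast
  qed
qed

section \<open>Quadratic forms\<close>

text \<open>The second order Taylor expansion at the origin: restricting a polynomial to the line through \<open>x\<close>
  gives a polynomial in \<open>t\<close> whose coefficient at \<open>t\<^sup>2\<close> is a quadratic form in \<open>x\<close>. For a homogeneous
  polynomial of degree 2 there is no other term. The coefficients of order 0 and 1 have to be
  controlled as well, because they enter the second order coefficient of a product.\<close>

lemma polynomial_second_order_part:
  assumes "real_polynomial_function p"
  shows "\<exists>c L B P. linear L \<and> bilinear B \<and> (\<forall>x t. p (t *\<^sub>R x) = poly (P x) t) \<and>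
    (\<forall>x. coeff (P x) 0 = c \<and> coeff (P x) 1 = L x \<and> coeff (P x) 2 = B x x)"
  using assms
proof induction
  case (linear f)
  then have "linear f" by (rule bounded_linear.linear)
  moreover have "bilinear (\<lambda>x y::'a. 0::real)" by (simp add: bilinear_def linear_zero)
  ultimately show ?case
    by (intro exI[of _ 0] exI[of _ f] exI[of _ "\<lambda>x y. 0"] exI[of _ "\<lambda>x. [:0, f x:]"])
       (simp add: linear_cmul numeral_2_eq_2)
next
  case (const c)
  show ?case
    by (intro exI[of _ c] exI[of _ "\<lambda>x. 0"] exI[of _ "\<lambda>x y. 0"] exI[of _ "\<lambda>x. [:c:]"])
       (simp add: numeral_2_eq_2 bilinear_def linear_zero)
next
  case (add f g)
  then obtain c L B P c' L' B' P' where
    "linear L" "bilinear B" "\<And>x t. f (t *\<^sub>R x) = poly (P x) t"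
    "\<And>x. coeff (P x) 0 = c \<and> coeff (P x) 1 = L x \<and> coeff (P x) 2 = B x x"
    "linear L'" "bilinear B'" "\<And>x t. g (t *\<^sub>R x) = poly (P' x) t"
    "\<And>x. coeff (P' x) 0 = c' \<and> coeff (P' x) 1 = L' x \<and> coeff (P' x) 2 = B' x x"
    by metis
  then show ?case
    by (intro exI[of _ "c + c'"] exI[of _ "\<lambda>x. L x + L' x"] exI[of _ "\<lambda>x y. B x y + B' x y"]
        exI[of _ "\<lambda>x. P x + P' x"])
       (simp add: linear_compose_add bilinear_def)
next
  case (mult f g)
  then obtain c L B P c' L' B' P' where
    *: "linear L" "bilinear B" "\<And>x t. f (t *\<^sub>R x) = poly (P x) t"
    "\<And>x. coeff (P x) 0 = c \<and> coeff (P x) 1 = L x \<and> coeff (P x) 2 = B x x"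
    "linear L'" "bilinear B'" "\<And>x t. g (t *\<^sub>R x) = poly (P' x) t"
    "\<And>x. coeff (P' x) 0 = c' \<and> coeff (P' x) 1 = L' x \<and> coeff (P' x) 2 = B' x x"
    by metis
  have "linear (\<lambda>x. c * L' x + c' * L x)"
    using * by (auto simp: linear_iff algebra_simps)
  moreover have "bilinear (\<lambda>x y. c * B' x y + c' * B x y + L x * L' y)"
    using * by (auto simp: bilinear_def linear_iff algebra_simps)
  moreover have "coeff (P x * P' x) 2 = c * B' x x + c' * B x x + L x * L' x" for x
    using *(4)[of x] *(8)[of x] by (simp add: coeff_mult numeral_2_eq_2 algebra_simps)
  moreover have "coeff (P x * P' x) 1 = c * L' x + c' * L x" for x
    using *(4)[of x] *(8)[of x] by (simp add: coeff_mult algebra_simps)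
  moreover have "coeff (P x * P' x) 0 = c * c'" for x
    using *(4)[of x] *(8)[of x] by (simp add: coeff_mult)
  ultimately show ?case
    by (intro exI[of _ "c * c'"] exI[of _ "\<lambda>x. c * L' x + c' * L x"]
        exI[of _ "\<lambda>x y. c * B' x y + c' * B x y + L x * L' y"] exI[of _ "\<lambda>x. P x * P' x"])
       (simp add: *)
qed

definition symmetric_bilinear :: "('v::real_vector \<Rightarrow> 'v \<Rightarrow> real) \<Rightarrow> bool" where
  "symmetric_bilinear B \<longleftrightarrow> bilinear B \<and> (\<forall>x y. B x y = B y x)"

lemma homogeneous_quadratic_polynomial:
  assumes "real_polynomial_function Q" "homogeneous_of_degree 2 Q"
  obtains B where "symmetric_bilinear B" "\<And>x. Q x = B x x"
proof -
  obtain c L B P where B: "bilinear B" and P: "\<And>x t. Q (t *\<^sub>R x) = poly (P x) t"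
    and c: "\<And>x. coeff (P x) 0 = c \<and> coeff (P x) 1 = L x \<and> coeff (P x) 2 = B x x"
    using polynomial_second_order_part[OF assms(1)] by metis
  have "Q x = B x x" for x
  proof -
    have "poly (P x) t = poly (monom (Q x) 2) t" for t
      using assms(2) P[of t x] by (simp add: homogeneous_of_degree_def poly_monom mult.commute)
    then have "P x = monom (Q x) 2"
      by (simp add: poly_eq_poly_eq_iff[symmetric] fun_eq_iff)
    then show ?thesis using c[of x] by simp
  qed
  moreover have "symmetric_bilinear (\<lambda>x y. (B x y + B y x) / 2)"
    using B by (auto simp: symmetric_bilinear_def bilinear_def linear_iff algebra_simps add_divide_distrib)
  ultimately show thesis using that[of "\<lambda>x y. (B x y + B y x) / 2"] by simp
qed

lemma symmetric_bilinear_expand: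
  assumes "symmetric_bilinear B"
  shows "B (x + t *\<^sub>R y) (x + t *\<^sub>R y) = B x x + 2 * t * B x y + t\<^sup>2 * B y y"
proof -
  have "bilinear B" "B y x = B x y" using assms by (auto simp: symmetric_bilinear_def)
  then show ?thesis
    by (simp add: bilinear_ladd bilinear_radd bilinear_lmul bilinear_rmul power2_eq_square
        algebra_simps)
qed

text \<open>Otherwise \<open>t \<mapsto> B (w + t v) (w + t v)\<close> would be affine and nonconstant, hence negative somewhere.\<close>

lemma psd_kernel:
  assumes B: "symmetric_bilinear B" and nonneg: "\<And>x. 0 \<le> B x x" and v: "B v v = 0"
  shows "B v w = 0"
proof (rule ccontr)
  assume b: "B v w \<noteq> 0"
  \<comment> \<open>the place where the affine function takes the value \<open>-1\<close>\<close>
  define t where "t = - (B w w + 1) / (2 * B v w)"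
  have "0 \<le> B (w + t *\<^sub>R v) (w + t *\<^sub>R v)" by (rule nonneg)
  also have "\<dots> = B w w + 2 * t * B v w"
    using B v by (simp add: symmetric_bilinear_expand) (simp add: symmetric_bilinear_def)
  also have "2 * t * B v w = - (B w w + 1)" using b by (simp add: t_def field_simps)
  finally show False by simp
qed

text \<open>At \<open>e\<close> the form \<open>A - R \<ge> 0\<close> vanishes, so \<open>e\<close> lies in its kernel and \<open>R e w = A e w\<close>. If \<open>B v v = 0\<close>, then
  \<open>v\<close> lies in the kernel of \<open>B\<close>, and the relation \<open>R\<^sup>2 + S\<^sup>2 = A B\<close> along the line \<open>e + t v\<close> reads
  \<open>(1 + 2 t A e v)\<^sup>2 + (2 t S e v)\<^sup>2 = 1 + 2 t A e v + t\<^sup>2 A v v\<close>; comparing coefficients gives the rest.\<close>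

lemma orthogonality_at_unit_point:
  assumes sb: "symmetric_bilinear A" "symmetric_bilinear B" "symmetric_bilinear R"
      "symmetric_bilinear S"
    and id: "\<And>x. (R x x)\<^sup>2 + (S x x)\<^sup>2 = A x x * B x x"
    and B: "\<And>x. 0 \<le> B x x" and AR: "\<And>x. R x x \<le> A x x"
    and e: "A e e = 1" "B e e = 1" "R e e = 1" "S e e = 0"
  shows "R e w = A e w"
    and "B v v = 0 \<Longrightarrow> A e v = 0" and "B v v = 0 \<Longrightarrow> 4 * (S e v)\<^sup>2 = A v v"
proof -
  have "symmetric_bilinear (\<lambda>x y. A x y - R x y)"
    using sb by (auto simp: symmetric_bilinear_def bilinear_def linear_iff algebra_simps)
  from psd_kernel[OF this, of e] AR e show RA: "R e w = A e w" for w by simp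
  assume v: "B v v = 0"
  have "(R v v)\<^sup>2 + (S v v)\<^sup>2 = 0" using id[of v] v by simp
  then have RS: "R v v = 0" "S v v = 0" by (simp_all add: sum_power2_eq_zero_iff)
  have "B e v = 0"
    using psd_kernel[OF sb(2) B v, of e] sb(2) by (simp add: symmetric_bilinear_def)
  then have eq: "(1 + 2 * t * A e v)\<^sup>2 + (2 * t * S e v)\<^sup>2 = 1 + 2 * t * A e v + t\<^sup>2 * A v v" for t
    using id[of "e + t *\<^sub>R v"] e v RS RA[of v] by (simp add: sb symmetric_bilinear_expand)
  show A0: "A e v = 0"
    using eq[of 1] eq[of "-1"] by (simp add: power2_eq_square algebra_simps)
  show "4 * (S e v)\<^sup>2 = A v v"
    using eq[of 1] A0 by (simp add: power2_eq_square)
qed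

text \<open>The previous lemma applies to \<open>e\<close> and, with \<open>-R\<close> for \<open>R\<close>, to \<open>f\<close>. It gives \<open>S f v = c S e v\<close> with
  \<open>c = 1\<close> or \<open>c = -1\<close>, so \<open>g = f - c e\<close> is orthogonal to \<open>v\<close> for both \<open>R\<close> and \<open>S\<close>. Then \<open>R\<^sup>2 + S\<^sup>2\<close> is
  constant along \<open>g + t v\<close> while \<open>A B\<close> has the term \<open>t\<^sup>2 (A v v) (B g g)\<close>, whence \<open>B g g = 0\<close>. Now \<open>g\<close> may
  take the place of \<open>v\<close>, so \<open>A e g = 0\<close>. But \<open>A e f = R e f = - A e f = 0\<close>, so \<open>A e g = -c\<close>.\<close>

lemma no_quadratic_model:
  assumes sb: "symmetric_bilinear A" "symmetric_bilinear B" "symmetric_bilinear R"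
      "symmetric_bilinear S"
    and id: "\<And>x. (R x x)\<^sup>2 + (S x x)\<^sup>2 = A x x * B x x"
    and B: "\<And>x. 0 \<le> B x x" and AR: "\<And>x. \<bar>R x x\<bar> \<le> A x x"
    and e: "A e e = 1" "B e e = 1" "R e e = 1" "S e e = 0"
    and f: "A f f = 1" "B f f = 1" "R f f = -1" "S f f = 0"
    and v: "B v v = 0" "0 < A v v"
  shows False
proof -
  have sbR: "symmetric_bilinear (\<lambda>x y. - R x y)"
    using sb(3) by (auto simp: symmetric_bilinear_def bilinear_def linear_iff)
  have le: "R x x \<le> A x x" "- R x x \<le> A x x" for x using AR[of x] by auto
  note E = orthogonality_at_unit_point[OF sb id B le(1) e]
  have "(- R x x)\<^sup>2 + (S x x)\<^sup>2 = A x x * B x x" for x by (simp add: id)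
  moreover have "- R f f = 1" by (simp add: f)
  ultimately have F: "- R f w = A f w" "B u u = 0 \<Longrightarrow> A f u = 0" "B u u = 0 \<Longrightarrow> 4 * (S f u)\<^sup>2 = A u u"
    for w u
    using orthogonality_at_unit_point[OF sb(1,2) sbR sb(4) _ B le(2) f(1,2) _ f(4)] by metis+
  have sym: "A x y = A y x" "R x y = R y x" "S x y = S y x" for x y
    using sb by (auto simp: symmetric_bilinear_def)
  have "(S f v)\<^sup>2 = (S e v)\<^sup>2" using E(3)[OF v(1)] F(3)[OF v(1)] by simp
  then obtain c where c: "c\<^sup>2 = (1::real)" "S f v = c * S e v"
    by (metis mult_1 mult_minus1 one_power2 power2_eq_iff power2_minus)
  define g where "g = f - c *\<^sub>R e"
  have lin: "M g x = M f x - c * M e x" if "symmetric_bilinear M" for M x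
  proof -
    have "bilinear M" using that by (simp add: symmetric_bilinear_def)
    then show ?thesis by (simp add: g_def bilinear_lsub bilinear_lmul)
  qed
  have gv: "R g v = 0" "S g v = 0"
    using E(1)[of v] E(2)[OF v(1)] F(1)[of v] F(2)[OF v(1)] c(2) by (simp_all add: lin sb)
  have "B v g = 0" by (rule psd_kernel[OF sb(2) B v(1)])
  then have Bgv: "B g v = 0" using sb(2) by (simp add: symmetric_bilinear_def)
  have RSv: "R v v = 0" "S v v = 0" using id[of v] v by (simp_all add: sum_power2_eq_zero_iff)
  have "(R g g)\<^sup>2 + (S g g)\<^sup>2 = (A g g + 2 * t * A g v + t\<^sup>2 * A v v) * B g g" for t
    using id[of "g + t *\<^sub>R v"] gv Bgv RSv v by (simp add: sb symmetric_bilinear_expand)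
  from this[of 0] this[of 1] this[of "-1"] have "A v v * B g g = 0"
    by (auto simp: algebra_simps)
  with v have "B g g = 0" by simp
  then have "A e g = 0" by (rule E(2))
  moreover have "A e f = 0" using E(1)[of f] F(1)[of e] sym[of e f] by simp
  moreover have "A e g = A f e - c * A e e" using lin[OF sb(1), of e] sym by metis
  ultimately have "c = 0" using e sym by simp
  with c show False by simp
qed

section \<open>The symplectic quotients\<close>

abbreviation weights :: "nat \<Rightarrow> int^3^1" where
  "weights a \<equiv> vector [vector [-1, 1, int a]]"

lemma zero_level_weights:
  "z \<in> zero_level (weights a) \<longleftrightarrow> (cmod (z$1))\<^sup>2 = (cmod (z$2))\<^sup>2 + a * (cmod (z$3))\<^sup>2"
  by (auto simp: zero_level_def moment_map_def sum_3 complex_mult_cnj cmod_power2)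

lemma circle_act_weights:
  "circle_act (weights a) t z = vector [inverse t * z$1, t * z$2, t ^ a * z$3]"
  by (simp add: circle_act_def vec_eq_iff forall_3 power_int_minus)

lemma simplicial_weights: "simplicial (weights a)"
proof -
  define b c :: "real^3" where "b = vector [1, 1, 0]" and "c = vector [a, 0, 1]"
  let ?B = "{b, c}"
  let ?K = "{x. (\<chi> i j. real_of_int (weights a $ i $ j)) *v x = 0 \<and> (\<forall>j. 0 \<le> x $ j)}"
  have K: "x \<in> ?K \<longleftrightarrow> x$1 = x$2 + a * x$3 \<and> 0 \<le> x$2 \<and> 0 \<le> x$3" for x
    by (auto simp: vec_eq_iff forall_3 matrix_vector_mult_def sum_3)
  have "independent ?B"
  proof -
    have "c \<notin> span {}" "b \<notin> span {c}"
      by (auto simp: b_def c_def vec_eq_iff forall_3 span_singleton)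
    then show ?thesis by (simp add: independent_insert)
  qed
  moreover have "?K \<subseteq> convex_cone hull ?B"
  proof
    fix x assume x: "x \<in> ?K"
    then have "x = (x$2) *\<^sub>R b + (x$3) *\<^sub>R c"
      unfolding K by (simp add: vec_eq_iff forall_3 b_def c_def mult.commute)
    moreover have "(x$2) *\<^sub>R b + (x$3) *\<^sub>R c \<in> convex_cone hull ?B"
      using x unfolding K by (intro convex_cone_hull_add convex_cone_hull_mul hull_inc) auto
    ultimately show "x \<in> convex_cone hull ?B" by simp
  qed
  moreover have "convex_cone hull ?B \<subseteq> ?K"
  proof (rule hull_minimal)
    show "?B \<subseteq> ?K" by (auto simp: K b_def c_def simp del: mem_Collect_eq)
    show "convex_cone ?K"
      unfolding convex_cone_iff K by (auto simp: K algebra_simps simp del: mem_Collect_eq)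
  qed
  ultimately show ?thesis unfolding simplicial_def by blast
qed

text \<open>An invariant map \<open>\<Phi>\<close> with a continuous section \<open>s\<close> that meets every orbit induces a homeomorphism:
  the inverse is the section followed by the orbit map, and continuous for that reason.\<close>

lemma quotient_top_homeomorphic_slice:
  fixes \<Phi> :: "'a::topological_space \<Rightarrow> 'b::topological_space"
  assumes \<Phi>: "continuous_on Z \<Phi>" and ne: "G \<noteq> {}"
    and inv: "\<And>g z. g \<in> G \<Longrightarrow> \<Phi> (g z) = \<Phi> z"
    and s: "continuous_on UNIV s" and sZ: "\<And>w. s w \<in> Z" and \<Phi>s: "\<And>w. \<Phi> (s w) = w"
    and orb: "\<And>z. z \<in> Z \<Longrightarrow> orbit_of G (s (\<Phi> z)) = orbit_of G z"
  shows "quotient_top G Z homeomorphic_space (euclidean :: 'b topology)"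
proof -
  define F where "F \<xi> = \<Phi> (SOME z. z \<in> Z \<and> orbit_of G z = \<xi>)" for \<xi>
  have F: "F (orbit_of G z) = \<Phi> z" if "z \<in> Z" for z
    unfolding F_def using ne inv that by (rule invariant_at_orbit_representative)
  have "continuous_map (quotient_top G Z) euclidean F"
    unfolding continuous_map_def topspace_quotient_top openin_quotient_top
  proof (intro conjI allI impI)
    fix U :: "'b set" assume "openin euclidean U"
    then have "openin (top_of_set Z) (Z \<inter> \<Phi> -` U)"
      using \<Phi> by (intro continuous_openin_preimage_gen) simp_all
    moreover have "{z \<in> Z. orbit_of G z \<in> orbit_of G ` Z \<and> F (orbit_of G z) \<in> U} = Z \<inter> \<Phi> -` U"
      using F by auto
    ultimately show "{x \<in> orbit_of G ` Z. F x \<in> U} \<subseteq> orbit_of G ` Z"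
        "openin (top_of_set Z) {z \<in> Z. orbit_of G z \<in> {x \<in> orbit_of G ` Z. F x \<in> U}}"
      by auto
  qed simp
  moreover have "continuous_map euclidean (quotient_top G Z) (\<lambda>w. orbit_of G (s w))"
    unfolding continuous_map_def topspace_quotient_top openin_quotient_top
  proof (intro conjI allI impI)
    show "(\<lambda>w. orbit_of G (s w)) \<in> topspace euclidean \<rightarrow> orbit_of G ` Z" using sZ by auto
    fix U assume "U \<subseteq> orbit_of G ` Z \<and> openin (top_of_set Z) {z \<in> Z. orbit_of G z \<in> U}"
    then obtain T where T: "open T" "{z \<in> Z. orbit_of G z \<in> U} = Z \<inter> T"
      by (auto simp: openin_open)
    then have "{w. orbit_of G (s w) \<in> U} = s -` T" using sZ by auto
    with T s show "openin euclidean {w \<in> topspace euclidean. orbit_of G (s w) \<in> U}"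
      by (simp add: open_vimage)
  qed
  ultimately have "homeomorphic_maps (quotient_top G Z) euclidean F (\<lambda>w. orbit_of G (s w))"
    unfolding homeomorphic_maps_def using F orb \<Phi>s sZ by (auto simp: topspace_quotient_top)
  then show ?thesis by (rule homeomorphic_maps_imp_homeomorphic_space)
qed

text \<open>The invariant map divides out the phase \<open>u = sgn z\<^sub>1\<close>, that is, it sends \<open>z\<close> to
  \<open>(u z\<^sub>2, u\<^sup>a z\<^sub>3)\<close>. Although \<open>u\<close> is discontinuous where \<open>z\<^sub>1 = 0\<close>, the only such point of the zero level is the
  origin, where the bound by the norm of \<open>z\<close> restores continuity. The section puts the nonnegative
  real solution \<open>z\<^sub>1\<close> of the moment map equation in front of \<open>(w\<^sub>1, w\<^sub>2)\<close>.\<close>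

lemma symplectic_quotient_weights_homeomorphic:
  assumes a: "0 < a"
  shows "space_top (symplectic_quotient (weights a)) homeomorphic_space
    (euclidean :: (complex^2) topology)"
proof -
  let ?Z = "zero_level (weights a)" and ?G = "circle_group (weights a)"
  define \<Phi> :: "complex^3 \<Rightarrow> complex^2"
    where "\<Phi> z = vector [sgn (z$1) * z$2, sgn (z$1) ^ a * z$3]" for z
  define r :: "complex^2 \<Rightarrow> real" where "r w = sqrt ((cmod (w$1))\<^sup>2 + a * (cmod (w$2))\<^sup>2)" for w
  define s :: "complex^2 \<Rightarrow> complex^3" where "s w = vector [of_real (r w), w$1, w$2]" for w
  have origin: "z = 0" if "z \<in> ?Z" "z$1 = 0" for z
  proof -
    have "0 = (cmod (z$2))\<^sup>2 + a * (cmod (z$3))\<^sup>2" using that by (simp add: zero_level_weights)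
    then have "(cmod (z$2))\<^sup>2 = 0" "a * (cmod (z$3))\<^sup>2 = 0"
      using add_nonneg_eq_0_iff[of "(cmod (z$2))\<^sup>2" "a * (cmod (z$3))\<^sup>2"] by simp_all
    with that a show ?thesis by (simp add: vec_eq_iff forall_3)
  qed
  have sgn1: "cmod (sgn (z$1)) \<le> 1" for z :: "complex^3" by (simp add: norm_sgn)
  have \<Phi>1: "cmod (\<Phi> z $ i) \<le> norm z" for z i
  proof (cases "i = 1")
    case True
    then show ?thesis
      using mult_mono[OF sgn1[of z] Finite_Cartesian_Product.norm_nth_le[of z 2]]
      by (simp add: \<Phi>_def norm_mult)
  next
    case False
    then have "i = 2" using exhaust_2 by blast
    then show ?thesis
      using mult_mono[OF power_le_one[OF norm_ge_zero sgn1[of z], of a] Finite_Cartesian_Product.norm_nth_le[of z 3]]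
      by (simp add: \<Phi>_def norm_mult norm_power)
  qed
  have "continuous_on ?Z \<Phi>"
    unfolding continuous_on_def
  proof
    fix z assume z: "z \<in> ?Z"
    show "(\<Phi> \<longlongrightarrow> \<Phi> z) (at z within ?Z)"
    proof (rule vec_tendstoI)
      fix i
      show "((\<lambda>x. \<Phi> x $ i) \<longlongrightarrow> \<Phi> z $ i) (at z within ?Z)"
      proof (cases "z$1 = 0")
        case True
        with z origin have "z = 0" by simp
        moreover have "((\<lambda>x. \<Phi> x $ i) \<longlongrightarrow> 0) (at 0 within ?Z)"
          by (rule Lim_null_comparison[of _ norm]) (auto simp: \<Phi>1 intro!: tendsto_eq_intros)
        moreover have "\<Phi> 0 $ i = 0" using \<Phi>1[of 0 i] by simp
        ultimately show ?thesis by simp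
      next
        case False
        then show ?thesis
          unfolding \<Phi>_def using exhaust_2[of i]
          by (elim disjE; simp; intro tendsto_intros; simp)
      qed
    qed
  qed
  moreover have "?G \<noteq> {}" by (simp add: circle_group_def)
  moreover have "\<Phi> (g z) = \<Phi> z" if g: "g \<in> ?G" for g z
  proof -
    from g obtain t where t: "cmod t = 1" "g = circle_act (weights a) t"
      by (auto simp: circle_group_def)
    have "sgn (inverse t * z$1) = inverse t * sgn (z$1)"
      using t by (simp add: sgn_div_norm norm_mult norm_inverse)
    moreover have "t \<noteq> 0" "sgn t = t" using t by (auto simp: sgn_div_norm)
    ultimately show ?thesis
      by (simp add: \<Phi>_def t circle_act_weights power_mult_distrib field_simps)
  qed
  moreover have "continuous_on UNIV s"
    unfolding continuous_on_def
  proof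
    fix w :: "complex^2"
    show "(s \<longlongrightarrow> s w) (at w within UNIV)"
    proof (rule vec_tendstoI)
      fix i
      show "((\<lambda>x. s x $ i) \<longlongrightarrow> s w $ i) (at w within UNIV)"
        unfolding s_def r_def using exhaust_3[of i]
        by (elim disjE; simp; intro tendsto_intros)
    qed
  qed
  moreover have "s w \<in> ?Z" for w
    by (simp add: s_def r_def zero_level_weights)
  moreover have "\<Phi> (s w) = w" for w
  proof (cases "r w = 0")
    case True
    then have "s w = 0" using origin \<open>s w \<in> ?Z\<close> by (simp add: s_def)
    then have "w = 0" by (auto simp: s_def vec_eq_iff forall_3 forall_2)
    moreover have "\<Phi> (s w) = 0"
      unfolding \<open>s w = 0\<close> by (simp add: \<Phi>_def vec_eq_iff forall_2)
    ultimately show ?thesis by simp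
  next
    case False
    moreover have "0 \<le> r w" by (simp add: r_def)
    ultimately have "sgn (of_real (r w) :: complex) = 1" by (simp add: sgn_of_real)
    then show ?thesis by (simp add: \<Phi>_def s_def vec_eq_iff forall_2)
  qed
  moreover have "orbit_of ?G (s (\<Phi> z)) = orbit_of ?G z" if z: "z \<in> ?Z" for z
  proof (cases "z$1 = 0")
    case True
    with z origin have "z = 0" by simp
    moreover have "s (\<Phi> 0) = 0" by (simp add: s_def \<Phi>_def r_def vec_eq_iff forall_3)
    ultimately show ?thesis by simp
  next
    case False
    let ?u = "sgn (z$1)"
    have u: "cmod ?u = 1" "?u \<noteq> 0" using False by (simp_all add: norm_sgn sgn_zero_iff)
    have "r (\<Phi> z) = cmod (z$1)"
    proof -
      have "(r (\<Phi> z))\<^sup>2 = (cmod (z$1))\<^sup>2"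
        using z u by (simp add: r_def \<Phi>_def zero_level_weights norm_mult norm_power)
      then show ?thesis by (simp add: r_def)
    qed
    moreover have "of_real (cmod (z$1)) = inverse ?u * z$1"
      using False by (simp add: sgn_div_norm scaleR_conv_of_real field_simps)
    ultimately have sz: "s (\<Phi> z) = circle_act (weights a) ?u z"
      by (simp add: circle_act_weights s_def \<Phi>_def vec_eq_iff forall_3)
    have comp: "circle_act (weights a) t (circle_act (weights a) t' z) =
        circle_act (weights a) (t * t') z" for t t'
      by (simp add: circle_act_weights vec_eq_iff forall_3 power_mult_distrib)
    have "(\<lambda>t. circle_act (weights a) (t * ?u) z) ` sphere 0 1 =
        (\<lambda>t. circle_act (weights a) t z) ` ((\<lambda>t. t * ?u) ` sphere 0 1)"
      by (simp add: image_image)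
    also have "(\<lambda>t. t * ?u) ` sphere 0 1 = sphere 0 1"
    proof (intro equalityI subsetI)
      fix t assume "t \<in> sphere (0::complex) 1"
      with u show "t \<in> (\<lambda>t. t * ?u) ` sphere 0 1"
        by (intro image_eqI[of _ _ "t / ?u"]) (simp_all add: norm_divide)
    qed (use u in \<open>auto simp: norm_mult\<close>)
    finally show ?thesis
      by (simp add: orbit_of_def circle_group_def image_image sz comp)
  qed
  ultimately have "quotient_top ?G ?Z homeomorphic_space (euclidean :: (complex^2) topology)"
    by (rule quotient_top_homeomorphic_slice)
  then show ?thesis by (simp add: symplectic_quotient_def reduced_space_def)
qed

lemma real_polynomial_coordinates:
  "real_polynomial_function (\<lambda>z::complex^3. Re (z$i))"
  "real_polynomial_function (\<lambda>z::complex^3. Im (z$i))"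
  by (auto intro!: real_polynomial_function.intros(1) bounded_linear_compose[OF bounded_linear_Re]
      bounded_linear_compose[OF bounded_linear_Im] bounded_linear_vec_nth)

lemma quadratic_invariants_weights:
  fixes a :: nat
  defines "I \<equiv> {f \<in> invariant_polynomials (circle_group (weights a)). homogeneous_of_degree 2 f}"
  shows "(\<lambda>z. (cmod (z$1))\<^sup>2) \<in> I" "(\<lambda>z. (cmod (z$2))\<^sup>2) \<in> I"
    "(\<lambda>z. Re (z$1 * z$2)) \<in> I" "(\<lambda>z. Im (z$1 * z$2)) \<in> I"
proof -
  have inv: "cmod (g z $ 1) = cmod (z$1)" "cmod (g z $ 2) = cmod (z$2)"
      "g z $ 1 * g z $ 2 = z$1 * z$2" if "g \<in> circle_group (weights a)" for g z
  proof -
    from that obtain t where "cmod t = 1" "g = circle_act (weights a) t"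
      by (auto simp: circle_group_def)
    moreover from this have "t \<noteq> 0" by auto
    ultimately show "cmod (g z $ 1) = cmod (z$1)" "cmod (g z $ 2) = cmod (z$2)"
      "g z $ 1 * g z $ 2 = z$1 * z$2"
      by (simp_all add: circle_act_weights norm_mult norm_inverse)
  qed
  have "real_polynomial_function (\<lambda>z::complex^3. (cmod (z$i))\<^sup>2)" for i
    unfolding cmod_power2 unfolding power2_eq_square
    by (intro real_polynomial_function.intros(3,4) real_polynomial_coordinates)
  moreover have "real_polynomial_function (\<lambda>z::complex^3. Re (z$1 * z$2))"
      "real_polynomial_function (\<lambda>z::complex^3. Im (z$1 * z$2))"
    unfolding times_complex.sel
    by (intro real_polynomial_function.intros(3,4) real_polynomial_function_diff
        real_polynomial_coordinates)+
  ultimately show "(\<lambda>z. (cmod (z$1))\<^sup>2) \<in> I" "(\<lambda>z. (cmod (z$2))\<^sup>2) \<in> I"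
    "(\<lambda>z. Re (z$1 * z$2)) \<in> I" "(\<lambda>z. Im (z$1 * z$2)) \<in> I"
    unfolding I_def invariant_polynomials_def homogeneous_of_degree_def invariant_def
    by (simp_all add: inv power_mult_distrib del: times_complex.sel)
       (simp_all add: power2_eq_square)
qed

lemma no_graded_symplectomorphism_to_linear_quotient:
  assumes a: "0 < a" and H: "H \<noteq> {}"
    and "invariant_chart (circle_group (weights a)) (zero_level (weights a)) \<phi> D"
    and "invariant_chart H UNIV \<psi> E"
  shows "\<not> graded_regular_symplectomorphism
    (symplectic_quotient (weights a)) \<phi> D (linear_quotient H) \<psi> E h"
proof
  let ?Z = "zero_level (weights a)" and ?G = "circle_group (weights a)"
  assume iso: "graded_regular_symplectomorphism
    (symplectic_quotient (weights a)) \<phi> D (linear_quotient H) \<psi> E h"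
  have G: "?G \<noteq> {}" by (simp add: circle_group_def)
  have cone: "\<forall>t. \<forall>z\<in>?Z. t *\<^sub>R z \<in> ?Z"
    by (simp add: zero_level_weights power_mult_distrib algebra_simps)
  obtain C where C: "\<forall>z\<in>?Z. \<exists>y\<in>UNIV. C z y" "\<forall>y\<in>UNIV. \<exists>z\<in>?Z. C z y"
    and transport: "\<forall>f\<in>invariant_polynomials ?G. \<forall>n. homogeneous_of_degree n f \<longrightarrow>
       (\<exists>Q\<in>invariant_polynomials H. homogeneous_of_degree n Q \<and>
         (\<forall>z\<in>?Z. \<forall>y\<in>UNIV. C z y \<longrightarrow> Q y = f z))"
    using graded_symplectomorphism_transports_invariants[OF assms(3,4)
        iso[unfolded symplectic_quotient_def linear_quotient_def] G H cone] by (elim exE conjE)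
  have form: "\<exists>B. symmetric_bilinear B \<and> (\<forall>z\<in>?Z. \<forall>y. C z y \<longrightarrow> B y y = f z)"
    if f: "f \<in> {f \<in> invariant_polynomials ?G. homogeneous_of_degree 2 f}" for f
  proof -
    obtain Q where Q: "Q \<in> invariant_polynomials H" "homogeneous_of_degree 2 Q"
      "\<forall>z\<in>?Z. \<forall>y\<in>UNIV. C z y \<longrightarrow> Q y = f z"
      using transport f by blast
    then have "real_polynomial_function Q" by (simp add: invariant_polynomials_def)
    with Q(2) obtain B where "symmetric_bilinear B" "\<And>x. Q x = B x x"
      using homogeneous_quadratic_polynomial by blast
    with Q(3) show ?thesis by (intro exI[of _ B]) auto
  qed
  obtain A where A: "symmetric_bilinear A" "\<And>z y. z \<in> ?Z \<Longrightarrow> C z y \<Longrightarrow> A y y = (cmod (z$1))\<^sup>2"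
    using form[OF quadratic_invariants_weights(1)] by metis
  obtain B where B: "symmetric_bilinear B" "\<And>z y. z \<in> ?Z \<Longrightarrow> C z y \<Longrightarrow> B y y = (cmod (z$2))\<^sup>2"
    using form[OF quadratic_invariants_weights(2)] by metis
  obtain R where R: "symmetric_bilinear R" "\<And>z y. z \<in> ?Z \<Longrightarrow> C z y \<Longrightarrow> R y y = Re (z$1 * z$2)"
    using form[OF quadratic_invariants_weights(3)] by metis
  obtain S where S: "symmetric_bilinear S" "\<And>z y. z \<in> ?Z \<Longrightarrow> C z y \<Longrightarrow> S y y = Im (z$1 * z$2)"
    using form[OF quadratic_invariants_weights(4)] by metis
  note val = A(2) B(2) R(2) S(2)
  define ze zf zv :: "complex^3"
    where "ze = vector [1, 1, 0]" and "zf = vector [1, -1, 0]"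
      and "zv = vector [of_real (sqrt a), 0, 1]"
  have Z: "ze \<in> ?Z" "zf \<in> ?Z" "zv \<in> ?Z"
    by (simp_all add: zero_level_weights ze_def zf_def zv_def)
  obtain e f v where y: "C ze e" "C zf f" "C zv v" using C(1) Z by metis
  have "(R x x)\<^sup>2 + (S x x)\<^sup>2 = A x x * B x x" for x
  proof -
    obtain z where "z \<in> ?Z" "C z x" using C(2) by blast
    then show ?thesis
      by (simp only: val cmod_power2[symmetric] norm_mult power_mult_distrib)
  qed
  moreover have "0 \<le> B x x" for x
  proof -
    obtain z where "z \<in> ?Z" "C z x" using C(2) by blast
    then show ?thesis by (simp add: val)
  qed
  moreover have "\<bar>R x x\<bar> \<le> A x x" for x
  proof -
    obtain z where z: "z \<in> ?Z" "C z x" using C(2) by blast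
    have "(cmod (z$2))\<^sup>2 \<le> (cmod (z$1))\<^sup>2" using z by (simp add: zero_level_weights)
    then have "cmod (z$2) \<le> cmod (z$1)" by simp
    then have "cmod (z$1 * z$2) \<le> (cmod (z$1))\<^sup>2"
      by (simp add: norm_mult power2_eq_square mult_left_mono)
    then show ?thesis
      using z val abs_Re_le_cmod[of "z$1 * z$2"] by simp
  qed
  ultimately show False
    by (rule no_quadratic_model[OF A(1) B(1) R(1) S(1), of e f v])
       (simp_all add: val[OF Z(1) y(1)] val[OF Z(2) y(2)] val[OF Z(3) y(3)]
         ze_def zf_def zv_def a)
qed

theorem mainTheorem4:
  fixes A :: "int^3^1"
  assumes "A = vector [vector [-1, 1, 1]] \<or> A = vector [vector [-1, 1, 2]]"
  shows "simplicial A \<and>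
    space_top (symplectic_quotient A) homeomorphic_space (euclidean :: (complex^2) topology) \<and>
    (\<forall>H. subgroup H Sp_R4 \<and> finite H \<longrightarrow>
      \<not> (\<exists>\<phi> D \<psi> E h.
          invariant_chart (circle_group A) (zero_level A) \<phi> D \<and>
          invariant_chart H UNIV \<psi> E \<and>
          graded_regular_symplectomorphism
            (symplectic_quotient A) \<phi> D (linear_quotient H) \<psi> E h))"
proof -
  obtain a where a: "0 < a" and A: "A = weights a"
  proof -
    have "A = weights 1 \<or> A = weights 2" using assms by simp
    then show thesis using that[of 1] that[of 2] by auto
  qed
  show ?thesis
    unfolding A
  proof (intro conjI allI impI)
    show "simplicial (weights a)" by (rule simplicial_weights)
    show "space_top (symplectic_quotient (weights a)) homeomorphic_space
        (euclidean :: (complex^2) topology)"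
      using a by (rule symplectic_quotient_weights_homeomorphic)
    fix H
    assume "subgroup H Sp_R4 \<and> finite H"
    then have "H \<noteq> {}" using subgroup.one_closed[of H Sp_R4] by auto
    from no_graded_symplectomorphism_to_linear_quotient[OF a this]
    show "\<not> (\<exists>\<phi> D \<psi> E h.
          invariant_chart (circle_group (weights a)) (zero_level (weights a)) \<phi> D \<and>
          invariant_chart H UNIV \<psi> E \<and>
          graded_regular_symplectomorphism
            (symplectic_quotient (weights a)) \<phi> D (linear_quotient H) \<psi> E h)"
      by iprover
  qed
qed

end
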